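(* Let $p$ be an odd prime, $m$ and $e$ positive integers, and $\lambda$ an odd integer with $-p^e<\lambda<p^e$. (i) The sequence of column vectors $\big(I_s(\boldsymbol z;\lambda)/T_s(\boldsymbol z;\lambda)\big)_{s\ge e}$, whose entries are rational functions in $\boldsymbol z$ regular on $\mathfrak D^{(m)}(\lambda)$, converges uniformly on $\mathfrak D^{(m)}(\lambda)$ as $s\to\infty$ to a vector whose entries are analytic functions on $\mathfrak D^{(m)}(\lambda)$. (ii) The sequence of column vectors $\big(I_s(\boldsymbol z;\lambda+2)/T_s(\boldsymbol z;\lambda)\big)_{s>2e}$, whose entries are rational functions in $\boldsymbol z$ regular on $\mathfrak D^{(m)}(\lambda)$, converges uniformly on $\mathfrak D^{(m)}(\lambda)$ as $s\to\infty$ to a vector whose entries are analytic functions on $\mathfrak D^{(m)}(\lambda)$. (iii) For $j=1,2$, the sequence of column vectors $\big(\frac{\partial I_s}{\partial z_j}(\boldsymbol z;\lambda)/T_s(\boldsymbol z;\lambda)\big)_{s\ge e}$, whose entries are rational functions in $\boldsymbol z$ regular on $\mathfrak D^{(m)}(\lambda)$, converges uniformly on $\mathfrak D^{(m)}(\lambda)$ as $s\to\infty$ to a vector whose entries are analytic functions on $\mathfrak D^{(m)}(\lambda)$.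
   Context: $\mathbb Q_p^{(m)}$ is the unramified extension of $\mathbb Q_p$ of degree $m$ in a fixed algebraic closure, with the norm $|\cdot|_p$ extending that of $\mathbb Q_p$; $\mathbb Z_p^{(m)}=\{a:|a|_p\le1\}$. Let $\boldsymbol z=(z_1,z_2)$. For an odd integer $\lambda$ with $-p^s<\lambda<p^s$ put $\Phi_s(t;\boldsymbol z;\lambda)=t^{(p^s-\lambda)/2}(t-z_1)^{(p^s-1)/2}(t-z_2)^{(p^s-1)/2}$. Let $T_s(\boldsymbol z;\lambda)\in\mathbb Z[\boldsymbol z]$ be the coefficient of $t^{p^s-1}$ in $\Phi_s$, and let $I_s=(I_{s,1},I_{s,2})$ be the column vector in which $I_{s,j}(\boldsymbol z;\lambda)\in\mathbb Z[\boldsymbol z]$ is the coefficient of $t^{p^s-1}$ in $\Phi_s/(t-z_j)$. For $w\in\{0,\dots,p-1\}$ let $h(\boldsymbol z;w)$ be the coefficient of $t^{p-1}$ in $t^w(t-z_1)^{(p-1)/2}(t-z_2)^{(p-1)/2}$. For an odd integer $\lambda$ let $-\lambda/2=\sum_{i\ge0}w_i(\lambda)p^i$, $0\le w_i(\lambda)\le p-1$, be the $p$-adic expansion, let $W(\lambda)=\{w_i(\lambda):i\ge0\}$ be the (finite) set of distinct digits, and let $H(\boldsymbol z;\lambda)=\prod_{w\in W(\lambda)}h(\boldsymbol z;w)$. Then $\mathfrak D^{(m)}(\lambda)=\{\boldsymbol a\in(\mathbb Z_p^{(m)})^2:|H(\boldsymbol a;\lambda)|_p=1\}$. A function on an open subset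 of $(\mathbb Z_p^{(m)})^2$ is analytic if it is locally given by convergent power series over $\mathbb Q_p^{(m)}$. *)

theory Defs
  imports
    "HOL-Algebra.Algebraic_Closure_Type"
    "HOL-Computational_Algebra.Computational_Algebra"
    "HOL-Analysis.Analysis"
begin

unbundle no Formal_Power_Series.fps_syntax

section \<open>The fields\<close>

definition nonarch_abs_on :: "'a::field set \<Rightarrow> ('a \<Rightarrow> real) \<Rightarrow> bool" where
  "nonarch_abs_on K N \<longleftrightarrow>
     (\<forall>x\<in>K. N x \<ge> 0 \<and> (N x = 0 \<longleftrightarrow> x = 0)) \<and>
     (\<forall>x\<in>K. \<forall>y\<in>K. N (x * y) = N x * N y) \<and>
     (\<forall>x\<in>K. \<forall>y\<in>K. N (x + y) \<le> max (N x) (N y))"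

definition padic_abs_rat :: "nat \<Rightarrow> rat \<Rightarrow> real" where
  "padic_abs_rat p x =
     (if x = 0 then 0
      else real p powi (int (multiplicity (int p) (snd (quotient_of x)))
                      - int (multiplicity (int p) (fst (quotient_of x)))))"

text \<open>
  The whole type \<open>'q\<close> with the absolute value \<open>v\<close> is the field of \<open>p\<close>-adic numbers, that is, the
  completion of the rationals with respect to the \<open>p\<close>-adic absolute value. This determines
  \<open>('q, v)\<close> up to a unique isometric isomorphism.
\<close>
definition padic_numbers :: "nat \<Rightarrow> ('q::field_char_0 \<Rightarrow> real) \<Rightarrow> bool" where
  "padic_numbers p v \<longleftrightarrow>
     nonarch_abs_on UNIV v \<and>
     (\<forall>x::rat. v (of_rat x) = padic_abs_rat p x) \<and>
     (\<forall>x. \<forall>\<epsilon>>0. \<exists>r::rat. v (x - of_rat r) < \<epsilon>) \<and>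
     (\<forall>u::nat \<Rightarrow> 'q.
        (\<forall>\<epsilon>>0. \<exists>M. \<forall>k\<ge>M. \<forall>n\<ge>M. v (u k - u n) < \<epsilon>) \<longrightarrow>
        (\<exists>x. (\<lambda>n. v (u n - x)) \<longlonglongrightarrow> 0))"

definition subfield_of :: "'a::field set \<Rightarrow> bool" where
  "subfield_of K \<longleftrightarrow>
     0 \<in> K \<and> 1 \<in> K \<and>
     (\<forall>x\<in>K. \<forall>y\<in>K. x + y \<in> K \<and> x * y \<in> K) \<and>
     (\<forall>x\<in>K. - x \<in> K \<and> inverse x \<in> K)"

text \<open>
  \<open>K\<close> is an extension of degree \<open>m\<close> (for \<open>m > 0\<close>) of the base field \<open>'q\<close> inside its algebraic
  closure, \<open>N\<close> is the extension of the absolute value \<open>v\<close> to \<open>K\<close>, and \<open>K\<close> is unramified: the value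
  groups of \<open>K\<close> and of the base field agree (ramification index 1).
  Only the values of \<open>N\<close> on \<open>K\<close> matter. Note that \<^term>\<open>vector_space.dim\<close> is 0 in the case of
  infinite dimension, so that a positive \<open>m\<close> does force a finite extension.
\<close>
definition unramified_extension ::
  "('q::field \<Rightarrow> real) \<Rightarrow> nat \<Rightarrow> 'q alg_closure set \<Rightarrow> ('q alg_closure \<Rightarrow> real) \<Rightarrow> bool" where
  "unramified_extension v m K N \<longleftrightarrow>
     subfield_of K \<and> range to_ac \<subseteq> K \<and>
     vector_space.dim (\<lambda>(c::'q) x. to_ac c * x) K = m \<and>
     nonarch_abs_on K N \<and> (\<forall>x. N (to_ac x) = v x) \<and>
     N ` (K - {0}) = v ` (UNIV - {0})"


section \<open>The polynomials\<close>

text \<open>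
  The ring of integer polynomials in \<open>z\<^sub>1, z\<^sub>2\<close> is the type \<^typ>\<open>int poly poly\<close>, with inner
  variable \<open>z\<^sub>1\<close> and outer variable \<open>z\<^sub>2\<close>; polynomials in \<open>t\<close> over it have type
  \<^typ>\<open>int poly poly poly\<close>.
\<close>

definition zvar :: "2 \<Rightarrow> int poly poly" where
  "zvar j = (if j = 1 then [:[:0, 1:]:] else [:0, 1:])"

definition t_minus_z :: "2 \<Rightarrow> int poly poly poly" where
  "t_minus_z j = [:- zvar j, 1:]"

definition eval2 :: "int poly poly \<Rightarrow> 'a::comm_ring_1 ^ 2 \<Rightarrow> 'a" where
  "eval2 f a = poly (map_poly (\<lambda>c. poly (map_poly of_int c) (a $ 1)) f) (a $ 2)"

definition pderiv2 :: "2 \<Rightarrow> int poly poly \<Rightarrow> int poly poly" where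
  "pderiv2 j f = (if j = 1 then map_poly pderiv f else pderiv f)"

text \<open>
  \<open>Phi\<close> is used for odd \<open>\<lambda>\<close> with \<open>-p\<^sup>s < \<lambda> < p\<^sup>s\<close> only, and then the argument of \<^const>\<open>nat\<close> is
  positive and the division by 2 is exact.
\<close>
definition Phi :: "nat \<Rightarrow> nat \<Rightarrow> int \<Rightarrow> int poly poly poly" where
  "Phi p s lam = [:0, 1:] ^ nat ((int p ^ s - lam) div 2)
     * t_minus_z 1 ^ ((p ^ s - 1) div 2) * t_minus_z 2 ^ ((p ^ s - 1) div 2)"

definition Tpol :: "nat \<Rightarrow> nat \<Rightarrow> int \<Rightarrow> int poly poly" where
  "Tpol p s lam = Polynomial.coeff (Phi p s lam) (p ^ s - 1)"

text \<open>The division by \<open>t - z\<^sub>j\<close> is exact, since \<open>(p\<^sup>s - 1) / 2 \<ge> 1\<close> for \<open>p\<close> odd and \<open>s \<ge> 1\<close>.\<close>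
definition Ivec :: "nat \<Rightarrow> nat \<Rightarrow> int \<Rightarrow> int poly poly ^ 2" where
  "Ivec p s lam = (\<chi> j. Polynomial.coeff (Phi p s lam div t_minus_z j) (p ^ s - 1))"

definition dIvec :: "2 \<Rightarrow> nat \<Rightarrow> nat \<Rightarrow> int \<Rightarrow> int poly poly ^ 2" where
  "dIvec j p s lam = (\<chi> k. pderiv2 j (Ivec p s lam $ k))"

definition hpol :: "nat \<Rightarrow> nat \<Rightarrow> int poly poly" where
  "hpol p w = Polynomial.coeff
     ([:0, 1:] ^ w * t_minus_z 1 ^ ((p - 1) div 2) * t_minus_z 2 ^ ((p - 1) div 2)) (p - 1)"

text \<open>
  The \<open>p\<close>-adic digits of a rational number \<open>x\<close> that is a \<open>p\<close>-adic integer. Both \<open>x\<close> and the partial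
  sums of its expansion are rational, so that the convergence can be expressed by the \<open>p\<close>-adic
  absolute value on the rationals.
\<close>
definition padic_digits :: "nat \<Rightarrow> rat \<Rightarrow> nat \<Rightarrow> nat" where
  "padic_digits p x = (THE w. (\<forall>i. w i \<le> p - 1) \<and>
     (\<lambda>n. padic_abs_rat p (x - (\<Sum>i<n. of_nat (w i) * of_nat p ^ i))) \<longlonglongrightarrow> 0)"

definition digit_set :: "nat \<Rightarrow> int \<Rightarrow> nat set" where
  "digit_set p lam = range (padic_digits p (- of_int lam / 2))"

definition Hpol :: "nat \<Rightarrow> int \<Rightarrow> int poly poly" where
  "Hpol p lam = (\<Prod>w\<in>digit_set p lam. hpol p w)"


section \<open>The domain and analytic functions\<close>

definition Ddom ::
  "nat \<Rightarrow> 'a::field set \<Rightarrow> ('a \<Rightarrow> real) \<Rightarrow> int \<Rightarrow> ('a ^ 2) set" where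
  "Ddom p K N lam = {a. (\<forall>i. a $ i \<in> K \<and> N (a $ i) \<le> 1) \<and> N (eval2 (Hpol p lam) a) = 1}"

text \<open>
  \<open>f\<close> is a \<open>K\<close>-valued analytic function on the open subset \<open>U\<close> of \<open>K\<^sup>2\<close>: around each point of \<open>U\<close>
  there is a polydisc contained in \<open>U\<close> on which \<open>f\<close> is the (unconditional) sum of a power series
  with coefficients in \<open>K\<close>. (A subset of the unit polydisc is open there iff it is open in \<open>K\<^sup>2\<close>.)
\<close>
definition nonarch_analytic_on ::
  "'a::field set \<Rightarrow> ('a \<Rightarrow> real) \<Rightarrow> ('a ^ 2) set \<Rightarrow> ('a ^ 2 \<Rightarrow> 'a) \<Rightarrow> bool" where
  "nonarch_analytic_on K N U f \<longleftrightarrow>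
     (\<forall>a\<in>U. \<exists>r>0. \<exists>c :: nat \<Rightarrow> nat \<Rightarrow> 'a. (\<forall>i j. c i j \<in> K) \<and>
        (\<forall>x. (\<forall>k. x $ k \<in> K \<and> N (x $ k - a $ k) < r) \<longrightarrow>
           x \<in> U \<and> f x \<in> K \<and>
           ((\<lambda>F. N (f x - (\<Sum>(i, j)\<in>F. c i j * (x $ 1 - a $ 1) ^ i * (x $ 2 - a $ 2) ^ j)))
              \<longlongrightarrow> 0) (finite_subsets_at_top UNIV)))"

text \<open>
  The sequence of column vectors \<open>A\<^sub>s / B\<^sub>s\<close>, for \<open>s \<ge> s\<^sub>0\<close>, consists of rational functions regular
  on \<open>D\<close> (the denominators have no zeros there) and converges uniformly on \<open>D\<close> to a vector of
  analytic functions.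
\<close>
definition converges_to_analytic ::
  "'a::field set \<Rightarrow> ('a \<Rightarrow> real) \<Rightarrow> ('a ^ 2) set \<Rightarrow> nat \<Rightarrow>
     (nat \<Rightarrow> int poly poly ^ 2) \<Rightarrow> (nat \<Rightarrow> int poly poly) \<Rightarrow> bool" where
  "converges_to_analytic K N D s0 A B \<longleftrightarrow>
     (\<forall>s\<ge>s0. \<forall>a\<in>D. eval2 (B s) a \<noteq> 0) \<and>
     (\<exists>F :: 'a ^ 2 \<Rightarrow> 'a ^ 2.
        (\<forall>k. nonarch_analytic_on K N D (\<lambda>a. F a $ k)) \<and>
        (\<forall>k. uniform_limit D (\<lambda>s a. N (eval2 (A s $ k) a / eval2 (B s) a - F a $ k))
               (\<lambda>_. 0) sequentially))"

end

theory Submission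
  imports Defs
begin

text \<open>
  All the vectors arise from the polynomials \<open>T\<^sub>s = Tpol p s lam\<close> by differentiation. Put
  \<open>a = (p\<^sup>s - 1) / 2\<close>. Differentiating \<open>(t - z\<^sub>j)\<^sup>a\<close> in the master polynomial gives
  \<open>\<partial>\<^sub>jT\<^sub>s = - a I\<^sub>s\<^sub>,\<^sub>j\<close>, and \<open>-2 a\<close> is 1 modulo \<open>p\<^sup>s\<close>. So the first claim says that the
  logarithmic derivatives of \<open>T\<^sub>s\<close> converge. It implies the third one by the quotient rule: with
  \<open>A\<^sub>s / T\<^sub>s\<close> and \<open>\<partial>\<^sub>jT\<^sub>s / T\<^sub>s\<close> also
  \<open>\<partial>\<^sub>jA\<^sub>s / T\<^sub>s = \<partial>\<^sub>j(A\<^sub>s / T\<^sub>s) + (A\<^sub>s / T\<^sub>s) (\<partial>\<^sub>jT\<^sub>s / T\<^sub>s)\<close> converges (\<open>ratio_cauchy_pderiv2\<close>). For the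
  second claim, the coefficient of \<open>t\<close> to the power \<open>p\<^sup>s - 1\<close> in a \<open>t\<close>-derivative is divisible by
  \<open>p\<^sup>s\<close>; applied to the master polynomial this gives
  \<open>\<lambda> T\<^sub>s(\<lambda> + 2) + I\<^sub>s\<^sub>,\<^sub>1 + I\<^sub>s\<^sub>,\<^sub>2 \<equiv> 0\<close> modulo \<open>p\<^sup>s\<close>. Dividing by the fixed nonzero integer \<open>\<lambda>\<close> loses only
  a bounded power of \<open>p\<close>, so \<open>T\<^sub>s(\<lambda> + 2) / T\<^sub>s(\<lambda>)\<close> converges, and then so does its derivative
  (\<open>ratio_cauchy_integrals\<close>).

  The convergence of the logarithmic derivatives rests on Dwork congruences. Let \<open>w\<^sub>i\<close> be the digits
  of \<open>-\<lambda>/2\<close>. For large \<open>s\<close> the master polynomial is the product over \<open>i < s\<close> of the powers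
  \<open>L\<^sub>i(t) ^ (p ^ i)\<close> of \<open>L\<^sub>i = t ^ w\<^sub>i ((t - z\<^sub>1) (t - z\<^sub>2)) ^ ((p - 1) / 2)\<close>. Let \<open>\<sigma>\<close> be the ring
  endomorphism with \<open>\<sigma> z\<^sub>j = z\<^sub>j\<^sup>p\<close>, and let a prime denote the shift of the sequence of digits. Then
  \<open>T\<^sub>s\<^sub>+\<^sub>1 \<sigma>(T'\<^sub>s\<^sub>-\<^sub>1) \<equiv> T\<^sub>s \<sigma>(T'\<^sub>s)\<close> modulo \<open>p\<^sup>s\<close> (\<open>dwork_congruence\<close>). Taking logarithmic derivatives,
  the right hand side of
  \<open>\<partial>T\<^sub>s\<^sub>+\<^sub>1 / T\<^sub>s\<^sub>+\<^sub>1 - \<partial>T\<^sub>s / T\<^sub>s \<equiv> \<partial>\<sigma>(T'\<^sub>s) / \<sigma>(T'\<^sub>s) - \<partial>\<sigma>(T'\<^sub>s\<^sub>-\<^sub>1) / \<sigma>(T'\<^sub>s\<^sub>-\<^sub>1)\<close>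
  gains a factor \<open>p\<close> from the chain rule, so that an induction on \<open>s\<close> shows that it vanishes modulo
  \<open>p\<^sup>s\<close> (\<open>dwork_log_derivative_congruence\<close>). Only degrees matter for the Dwork congruences: \<open>L\<^sub>i\<close> has
  degree at most \<open>2 (p - 1)\<close>, so that modulo \<open>p\<close> exactly one coefficient of \<open>L\<^sub>0\<close>, which is
  \<open>h(w\<^sub>0)\<close>, contributes to \<open>T\<^sub>s\<close>. This one-dimensionality makes the passage from \<open>s\<close> to \<open>s + 1\<close>
  a contraction. It also gives \<open>T\<^sub>s \<equiv> h(w\<^sub>0) (T'\<^sub>s\<^sub>-\<^sub>1)\<^sup>p\<close>, whence \<open>T\<^sub>s\<close> has absolute value 1 on the domain.

  Finally, these congruences hold between polynomials with integer coefficients and therefore also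
  for the coefficients of Taylor expansions at a point of the domain. There \<open>A\<^sub>s / T\<^sub>s\<close> is
  approximated by polynomials that form a Cauchy sequence for the Gauss norm of a smaller polydisc.
  As \<open>K\<close> is complete, being of finite dimension over the \<open>p\<close>-adic numbers, the coefficients
  converge, and their limits are those of the power series of the limit function
  (\<open>ratio_cauchy_converges_to_analytic\<close>).
\<close>

section \<open>Ring homomorphisms and Frobenius lifts\<close>

locale comm_ring_morphism =
  fixes h :: "'a::comm_ring_1 \<Rightarrow> 'b::comm_ring_1"
  assumes add: "h (x + y) = h x + h y"
    and mult: "h (x * y) = h x * h y"
    and one: "h 1 = 1"
begin

lemma zero: "h 0 = 0"
  using add[of 0 0] by simp

lemma uminus: "h (- x) = - h x"
  using add[of x "- x"] zero by (simp add: eq_neg_iff_add_eq_0 add.commute)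

lemma diff: "h (x - y) = h x - h y"
  using add[of x "- y"] uminus[of y] by simp

lemma power: "h (x ^ n) = h x ^ n"
  by (induction n) (simp_all add: one mult)

lemma of_nat: "h (of_nat n) = of_nat n"
  by (induction n) (simp_all add: zero one add)

lemma of_int: "h (of_int n) = of_int n"
  by (cases n rule: int_cases2) (simp_all add: of_nat uminus)

lemma dvd: "x dvd y \<Longrightarrow> h x dvd h y"
  by (auto simp: dvd_def mult)

end

lemma comm_ring_morphism_id: "comm_ring_morphism (\<lambda>x. x)"
  by unfold_locales simp_all

lemma comm_ring_morphism_of_int: "comm_ring_morphism of_int"
  by unfold_locales simp_all

lemma comm_ring_morphism_funpow:
  fixes f :: "'a::comm_ring_1 \<Rightarrow> 'a"
  assumes "comm_ring_morphism f"
  shows "comm_ring_morphism (f ^^ n)"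
proof (induction n)
  case 0
  show ?case by (simp add: comm_ring_morphism_def id_def)
next
  case (Suc n)
  then show ?case using assms by (simp add: comm_ring_morphism_def)
qed

text \<open>
  The extension of \<open>h\<close> to polynomials that sends the variable to \<open>x\<close>. Both the evaluation of integer
  polynomials and the Frobenius lifts are instances, so that they share one proof of multiplicativity.
\<close>
definition poly_lift :: "('a::comm_ring_1 \<Rightarrow> 'b::comm_ring_1) \<Rightarrow> 'b \<Rightarrow> 'a poly \<Rightarrow> 'b" where
  "poly_lift h x f = poly (map_poly h f) x"

context comm_ring_morphism
begin

lemma poly_lift_pCons: "poly_lift h x (pCons c f) = h c + x * poly_lift h x f"
  by (simp add: poly_lift_def map_poly_pCons zero)

lemma poly_lift_0: "poly_lift h x 0 = 0"
  by (simp add: poly_lift_def)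

lemma poly_lift_add: "poly_lift h x (f + g) = poly_lift h x f + poly_lift h x g"
  by (induction f g rule: poly_induct2)
    (simp_all add: poly_lift_pCons poly_lift_0 add algebra_simps)

lemma poly_lift_smult: "poly_lift h x (Polynomial.smult c f) = h c * poly_lift h x f"
  by (induction f) (simp_all add: poly_lift_pCons poly_lift_0 mult algebra_simps)

lemma poly_lift_mult: "poly_lift h x (f * g) = poly_lift h x f * poly_lift h x g"
  by (induction f)
    (simp_all add: poly_lift_pCons poly_lift_0 poly_lift_add poly_lift_smult zero algebra_simps)

lemma morphism_poly_lift: "comm_ring_morphism (poly_lift h x)"
proof
  show "poly_lift h x 1 = 1"
    by (simp add: one_pCons poly_lift_pCons poly_lift_0 one)
qed (simp_all add: poly_lift_add poly_lift_mult)

end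

text \<open>
  The extension of a Frobenius lift \<open>\<sigma>\<close> of the coefficients by \<open>t \<mapsto> t ^ p\<close>.
\<close>
definition frob_ext :: "nat \<Rightarrow> ('a::comm_ring_1 \<Rightarrow> 'a) \<Rightarrow> 'a poly \<Rightarrow> 'a poly" where
  "frob_ext p \<sigma> = poly_lift (\<lambda>c. [:\<sigma> c:]) (Polynomial.monom 1 p)"

lemma dvd_power_add_diff:
  fixes x y :: "'a::comm_ring_1"
  assumes "prime p"
  shows "of_nat p dvd (x + y) ^ p - (x ^ p + y ^ p)"
proof -
  have p: "p \<ge> 2" using assms prime_ge_2_nat by blast
  have split: "{..p} = insert 0 (insert p {1..<p})" using p by auto
  have "(x + y) ^ p = (\<Sum>k\<le>p. of_nat (p choose k) * x ^ k * y ^ (p - k))"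
    by (rule binomial_ring)
  also have "\<dots> = x ^ p + y ^ p + (\<Sum>k\<in>{1..<p}. of_nat (p choose k) * x ^ k * y ^ (p - k))"
    unfolding split using p by (subst sum.insert) auto
  finally have eq: "(x + y) ^ p - (x ^ p + y ^ p) =
      (\<Sum>k\<in>{1..<p}. of_nat (p choose k) * x ^ k * y ^ (p - k))" by simp
  have "of_nat p dvd (of_nat (p choose k) :: 'a)" if k: "k \<in> {1..<p}" for k
  proof -
    have "p dvd (p choose k)"
      by (rule dvd_choose_prime) (use k assms in auto)
    then show ?thesis by (auto simp: dvd_def)
  qed
  then show ?thesis unfolding eq by (auto intro!: dvd_sum dvd_mult2)
qed

text \<open>
  Each passage to \<open>p\<close>-th powers gains a factor \<open>p\<close>: if \<open>x \<equiv> y\<close> modulo \<open>p\<close>, then all \<open>p\<close> summands of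
  \<open>(x ^ p - y ^ p) / (x - y)\<close> are congruent to each other modulo \<open>p\<close>.
\<close>
lemma dvd_power_p_power_diff:
  fixes x y :: "'a::comm_ring_1"
  assumes "prime p" and "of_nat p dvd x - y"
  shows "of_nat p ^ Suc j dvd x ^ p ^ j - y ^ p ^ j"
proof (induction j)
  case 0
  then show ?case using assms by simp
next
  case (Suc j)
  define U where "U = x ^ p ^ j"
  define V where "V = y ^ p ^ j"
  have d: "of_nat p ^ Suc j dvd U - V" using Suc by (simp add: U_def V_def)
  have pU: "of_nat p dvd U - V" using d by (meson dvd_power dvd_trans zero_less_Suc)
  have dpow: "of_nat p dvd U ^ i - V ^ i" for i
    by (rule dvd_trans[OF pU]) (metis power_diff_sumr2 dvd_triv_left)
  have "(\<Sum>i<p. V ^ (p - Suc i) * U ^ i) =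
      (\<Sum>i<p. V ^ (p - Suc i) * (U ^ i - V ^ i)) + (\<Sum>i<p. V ^ (p - Suc i) * V ^ i)"
    by (simp add: sum.distrib[symmetric] algebra_simps)
  also have "(\<Sum>i<p. V ^ (p - Suc i) * V ^ i) = (\<Sum>i<p. V ^ (p - 1))"
    by (intro sum.cong) (auto simp: power_add[symmetric])
  also have "\<dots> = of_nat p * V ^ (p - 1)" by simp
  finally have "of_nat p dvd (\<Sum>i<p. V ^ (p - Suc i) * U ^ i)"
    by (simp only:) (intro dvd_add dvd_sum dvd_mult dpow dvd_triv_left)
  then have "of_nat p ^ Suc j * of_nat p dvd (U - V) * (\<Sum>i<p. V ^ (p - Suc i) * U ^ i)"
    using d by (rule mult_dvd_mono[rotated])
  then have "of_nat p ^ Suc (Suc j) dvd U ^ p - V ^ p"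
    unfolding power_diff_sumr2[of U p V] by (simp only: power_Suc2)
  then show ?case
    by (simp add: U_def V_def power_mult[symmetric] mult.commute)
qed

text \<open>
  A ring endomorphism that reduces modulo \<open>p\<close> to the \<open>p\<close>-th power map.
\<close>
locale frobenius_lift = comm_ring_morphism \<sigma> for \<sigma> :: "'a::comm_ring_1 \<Rightarrow> 'a" +
  fixes p :: nat
  assumes prime_p: "prime p"
    and frob: "of_nat p dvd \<sigma> x - x ^ p"
begin

abbreviation "\<phi> \<equiv> frob_ext p \<sigma>"

lemma const_morphism: "comm_ring_morphism (\<lambda>c. [:\<sigma> c:])"
  by unfold_locales (simp_all add: add mult one one_pCons)

lemma frob_ext_pCons: "\<phi> (pCons c f) = [:\<sigma> c:] + Polynomial.monom 1 p * \<phi> f"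
  unfolding frob_ext_def by (rule comm_ring_morphism.poly_lift_pCons[OF const_morphism])

lemma frob_ext_morphism: "comm_ring_morphism \<phi>"
  unfolding frob_ext_def by (rule comm_ring_morphism.morphism_poly_lift[OF const_morphism])

lemma coeff_frob_ext:
  "Polynomial.coeff (\<phi> f) n = (if p dvd n then \<sigma> (Polynomial.coeff f (n div p)) else 0)"
proof (induction f arbitrary: n)
  case 0
  then show ?case using comm_ring_morphism.zero[OF frob_ext_morphism] by (simp add: zero)
next
  case (pCons c f)
  have p: "p > 0" using prime_p prime_gt_0_nat by blast
  show ?case
  proof (cases "n < p")
    case True
    then show ?thesis using p
      by (auto simp: frob_ext_pCons coeff_monom_mult coeff_pCons zero split: nat.splits)
  next
    case False
    then have "n div p = Suc ((n - p) div p)" "p dvd n - p \<longleftrightarrow> p dvd n" "n \<noteq> 0"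
      using p by (auto simp: le_div_geq dvd_minus_self)
    then show ?thesis using False pCons.IH[of "n - p"]
      by (auto simp: frob_ext_pCons coeff_monom_mult coeff_pCons split: nat.splits)
  qed
qed

lemma degree_frob_ext_le: "Polynomial.degree (\<phi> f) \<le> p * Polynomial.degree f"
proof (rule degree_le, intro allI impI)
  fix i assume i: "p * Polynomial.degree f < i"
  have p: "p > 0" using prime_p prime_gt_0_nat by blast
  show "Polynomial.coeff (\<phi> f) i = 0"
  proof (cases "p dvd i")
    case True
    then obtain k where "i = p * k" by blast
    then show ?thesis using i p by (simp add: coeff_frob_ext coeff_eq_0 zero)
  qed (simp add: coeff_frob_ext)
qed

text \<open>
  This permits the adjunction of one variable after another, starting with the identity of the
  integers, which lifts Frobenius by Fermat's little theorem.
\<close>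
lemma frobenius_lift_frob_ext: "frobenius_lift \<phi> p"
proof -
  interpret E: comm_ring_morphism \<phi> by (rule frob_ext_morphism)
  show ?thesis
  proof
    fix f :: "'a poly"
    show "of_nat p dvd \<phi> f - f ^ p"
    proof (induction f)
      case 0
      have "p > 0" using prime_p prime_gt_0_nat by blast
      then show ?case using E.zero by (simp add: power_0_left)
    next
      case (pCons c f)
      obtain k where "\<sigma> c - c ^ p = of_nat p * k" using frob[of c] by (auto simp: dvd_def)
      then have "[:\<sigma> c - c ^ p:] = of_nat p * [:k:]" by (simp add: of_nat_poly)
      then have "of_nat p dvd ([:\<sigma> c - c ^ p:] :: 'a poly)" by (rule dvdI)
      moreover have "of_nat p dvd Polynomial.monom 1 p * (\<phi> f - f ^ p)"
        using pCons by simp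
      moreover have "of_nat p dvd ([:c:] + [:0, 1:] * f) ^ p - ([:c:] ^ p + ([:0, 1:] * f) ^ p)"
        by (rule dvd_power_add_diff[OF prime_p])
      ultimately have "of_nat p dvd [:\<sigma> c - c ^ p:] + Polynomial.monom 1 p * (\<phi> f - f ^ p)
          - (([:c:] + [:0, 1:] * f) ^ p - ([:c:] ^ p + ([:0, 1:] * f) ^ p))"
        by (rule dvd_diff[OF dvd_add])
      also have "[:c:] ^ p = [:c ^ p:]" by (simp add: poly_const_pow)
      also have "[:c:] + [:0, 1:] * f = pCons c f" by simp
      also have "([:0, 1:] * f) ^ p = Polynomial.monom 1 p * f ^ p"
        unfolding power_mult_distrib monom_altdef by simp
      also have "[:\<sigma> c - c ^ p:] + Polynomial.monom 1 p * (\<phi> f - f ^ p)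
          - (pCons c f ^ p - ([:c ^ p:] + Polynomial.monom 1 p * f ^ p)) = \<phi> (pCons c f) - pCons c f ^ p"
        by (simp add: frob_ext_pCons algebra_simps)
      finally show ?case .
    qed
  qed (rule prime_p)
qed

end

section \<open>Dwork congruences\<close>

definition dwork_prod :: "nat \<Rightarrow> (nat \<Rightarrow> 'a::comm_ring_1 poly) \<Rightarrow> nat \<Rightarrow> 'a poly" where
  "dwork_prod p \<Lambda> n = (\<Prod>i<n. \<Lambda> i ^ p ^ i)"

text \<open>
  This is the constant term of a product of Laurent polynomials in disguise: for \<open>n\<close> factors, the
  product over \<open>i < n\<close> of the powers \<open>(t ^ (p - 1)) ^ (p ^ i)\<close> is \<open>t ^ (p ^ n - 1)\<close>.
\<close>
definition dwork_coeff :: "nat \<Rightarrow> (nat \<Rightarrow> 'a::comm_ring_1 poly) \<Rightarrow> nat \<Rightarrow> 'a" where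
  "dwork_coeff p \<Lambda> n = Polynomial.coeff (dwork_prod p \<Lambda> n) (p ^ n - 1)"

lemma dwork_prod_0 [simp]: "dwork_prod p \<Lambda> 0 = 1"
  by (simp add: dwork_prod_def)

lemma dwork_prod_Suc:
  "dwork_prod p \<Lambda> (Suc n) = \<Lambda> 0 * dwork_prod p (\<lambda>i. \<Lambda> (Suc i)) n ^ p"
  unfolding dwork_prod_def
  by (simp only: prod.lessThan_Suc_shift prod_power_distrib o_def power_mult[symmetric]
      power_Suc2 power_0 power_one_right)

context frobenius_lift
begin

lemma funpow_frob_ext_morphism: "comm_ring_morphism (\<phi> ^^ n)"
  by (rule comm_ring_morphism_funpow[OF frob_ext_morphism])

lemma coeff_funpow_frob_ext:
  "Polynomial.coeff ((\<phi> ^^ l) f) n =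
     (if p ^ l dvd n then (\<sigma> ^^ l) (Polynomial.coeff f (n div p ^ l)) else 0)"
proof (induction l arbitrary: n)
  case (Suc l)
  have p: "p > 0" using prime_p prime_gt_0_nat by blast
  show ?case
  proof (cases "p dvd n")
    case True
    then obtain k where k: "n = p * k" by blast
    then show ?thesis using p by (simp add: coeff_frob_ext Suc zero)
  next
    case False
    then have "\<not> p ^ Suc l dvd n" by (metis dvd_mult_left power_Suc)
    then show ?thesis using False by (simp add: coeff_frob_ext)
  qed
qed simp

lemma degree_funpow_frob_ext_le: "Polynomial.degree ((\<phi> ^^ l) f) \<le> p ^ l * Polynomial.degree f"
proof (induction l)
  case (Suc l)
  have "Polynomial.degree ((\<phi> ^^ Suc l) f) \<le> p * Polynomial.degree ((\<phi> ^^ l) f)"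
    by (simp add: degree_frob_ext_le)
  also have "\<dots> \<le> p * (p ^ l * Polynomial.degree f)" using Suc by simp
  finally show ?case by (simp add: mult.assoc)
qed simp

text \<open>
  The exponents of \<open>t\<close> in the second factor are multiples of \<open>p ^ l\<close>. As \<open>p ^ (l + n) - 1\<close> is \<open>-1\<close>
  modulo \<open>p ^ l\<close>, the only exponent up to \<open>2 (p ^ l - 1)\<close> that can complement such a multiple is
  \<open>p ^ l - 1\<close>. So the coefficient factors; the degree bound is what makes the theory one-dimensional.
\<close>
lemma coeff_mult_funpow_frob_ext:
  assumes deg: "Polynomial.degree Q \<le> 2 * (p ^ l - 1)"
  shows "Polynomial.coeff (Q * (\<phi> ^^ l) F) (p ^ (l + n) - 1) =
    Polynomial.coeff Q (p ^ l - 1) * (\<sigma> ^^ l) (Polynomial.coeff F (p ^ n - 1))"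
proof -
  let ?c = "Polynomial.coeff Q (p ^ l - 1) * (\<sigma> ^^ l) (Polynomial.coeff F (p ^ n - 1))"
  have p: "p > 0" using prime_p prime_gt_0_nat by blast
  have pl: "p ^ l > 0" and pn: "p ^ n > 0" using p by simp_all
  have "Polynomial.coeff Q i * Polynomial.coeff ((\<phi> ^^ l) F) (p ^ (l + n) - 1 - i)
      = (if i = p ^ l - 1 then ?c else 0)" if i: "i \<le> p ^ (l + n) - 1" for i
  proof (cases "i = p ^ l - 1")
    case True
    have "p ^ (l + n) - 1 - (p ^ l - 1) = p ^ l * (p ^ n - 1)"
      using pl pn by (simp add: power_add diff_mult_distrib2)
    then show ?thesis using True pl by (simp add: coeff_funpow_frob_ext)
  next
    case False
    have "Polynomial.coeff Q i = 0" if "p ^ l dvd p ^ (l + n) - 1 - i"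
    proof -
      have "p ^ l dvd p ^ (l + n) - (p ^ (l + n) - 1 - i)"
        using dvd_diff_nat[OF _ that] by (simp add: power_add)
      also have "p ^ (l + n) - (p ^ (l + n) - 1 - i) = i + 1"
      proof -
        have "p ^ (l + n) > 0" using p by simp
        then show ?thesis using i by linarith
      qed
      finally obtain k where k: "i + 1 = p ^ l * k" by blast
      have "k \<noteq> 0" using k by (cases k) auto
      moreover have "k \<noteq> 1" using k False by auto
      ultimately have "p ^ l * 2 \<le> p ^ l * k" by (intro mult_le_mono2) simp
      then have "Polynomial.degree Q < i" using k deg pl by linarith
      then show ?thesis by (rule coeff_eq_0)
    qed
    then show ?thesis using False by (auto simp: coeff_funpow_frob_ext)
  qed
  then have "Polynomial.coeff (Q * (\<phi> ^^ l) F) (p ^ (l + n) - 1)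
      = (\<Sum>i\<le>p ^ (l + n) - 1. if i = p ^ l - 1 then ?c else 0)"
    by (simp add: coeff_mult)
  also have "\<dots> = ?c"
    using p by (simp add: sum.delta power_add) (simp add: diff_le_mono Suc_leI)
  finally show ?thesis .
qed

text \<open>
  Modulo \<open>p\<close>, the \<open>p\<close>-th power of the product of the remaining factors may be replaced by its image
  under \<open>\<phi>\<close>, and then the coefficient factors.
\<close>
lemma p_dvd_dwork_coeff_Suc_diff:
  fixes \<Lambda> :: "nat \<Rightarrow> 'a poly"
  assumes "Polynomial.degree (\<Lambda> 0) \<le> 2 * (p - 1)"
  shows "of_nat p dvd dwork_coeff p \<Lambda> (Suc n)
    - Polynomial.coeff (\<Lambda> 0) (p - 1) * dwork_coeff p (\<lambda>i. \<Lambda> (Suc i)) n ^ p"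
proof -
  interpret E: frobenius_lift \<phi> p by (rule frobenius_lift_frob_ext)
  let ?F = "dwork_prod p (\<lambda>i. \<Lambda> (Suc i)) n"
  let ?c = "Polynomial.coeff (\<Lambda> 0) (p - 1)"
  let ?T = "dwork_coeff p (\<lambda>i. \<Lambda> (Suc i)) n"
  obtain R where R: "\<phi> ?F - ?F ^ p = of_nat p * R" using E.frob[of ?F] by (auto simp: dvd_def)
  have "dwork_prod p \<Lambda> (Suc n) = \<Lambda> 0 * (\<phi> ^^ 1) ?F - of_nat p * (\<Lambda> 0 * R)"
    using R by (simp add: dwork_prod_Suc algebra_simps)
  then have "dwork_coeff p \<Lambda> (Suc n) = Polynomial.coeff (\<Lambda> 0 * (\<phi> ^^ 1) ?F) (p ^ (1 + n) - 1)
      - of_nat p * Polynomial.coeff (\<Lambda> 0 * R) (p ^ (1 + n) - 1)"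
    by (simp add: dwork_coeff_def of_nat_poly)
  also have "Polynomial.coeff (\<Lambda> 0 * (\<phi> ^^ 1) ?F) (p ^ (1 + n) - 1) = ?c * \<sigma> ?T"
    by (subst coeff_mult_funpow_frob_ext) (use assms in \<open>simp_all add: dwork_coeff_def\<close>)
  finally have "dwork_coeff p \<Lambda> (Suc n) - ?c * ?T ^ p =
      ?c * (\<sigma> ?T - ?T ^ p) - of_nat p * Polynomial.coeff (\<Lambda> 0 * R) (p ^ (1 + n) - 1)"
    by (simp add: algebra_simps)
  then show ?thesis using frob[of ?T] by (simp add: dvd_diff)
qed

end

text \<open>
  The indices \<open>l\<close> and \<open>n\<close> of \<open>W l n\<close> and \<open>T l n\<close> stand for the block of \<open>n\<close> consecutive factors
  that begins with \<open>\<Lambda> l\<close>.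
\<close>
locale dwork_sequence = frobenius_lift \<sigma> p
  for \<sigma> :: "'a::{idom, ring_char_0} \<Rightarrow> 'a" and p +
  fixes \<Lambda> :: "nat \<Rightarrow> 'a poly"
  assumes degree_le: "Polynomial.degree (\<Lambda> i) \<le> 2 * (p - 1)"
begin

abbreviation W :: "nat \<Rightarrow> nat \<Rightarrow> 'a poly" where
  "W l n \<equiv> dwork_prod p (\<lambda>i. \<Lambda> (l + i)) n"

abbreviation T :: "nat \<Rightarrow> nat \<Rightarrow> 'a" where
  "T l n \<equiv> dwork_coeff p (\<lambda>i. \<Lambda> (l + i)) n"

lemma W_Suc: "W l (Suc n) = \<Lambda> l * W (Suc l) n ^ p"
  by (simp add: dwork_prod_Suc)

text \<open>
  The Dwork congruence is the vanishing modulo a power of \<open>p\<close> of a \<open>2 \<times> 2\<close> determinant, whose rows are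
  pairs of coefficients that belong to the blocks with last factor \<open>\<Lambda> (l + k - 1)\<close> (first component) and
  \<open>\<Lambda> (l + k - 2)\<close> (second component). The module records the contraction: up to \<open>p\<close> times a pair
  of the next module, a pair is a multiple of the single generator
  \<open>(\<sigma> ^^ l) (T l k), (\<sigma> ^^ l) (T l (k - 1))\<close>. The recursion ends beyond the end of the second
  block, where the second component vanishes.
\<close>
fun dwork_module :: "nat \<Rightarrow> nat \<Rightarrow> ('a \<times> 'a) set" where
  "dwork_module l 0 = {(x, 0) |x. True}"
| "dwork_module l (Suc k) =
     {(a * (\<sigma> ^^ l) (T l (Suc k)) + of_nat p * x, a * (\<sigma> ^^ l) (T l k) + of_nat p * y) |a x y.
        (x, y) \<in> dwork_module (Suc l) k}"

lemma dwork_module_add: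
  "(x, y) \<in> dwork_module l k \<Longrightarrow> (x', y') \<in> dwork_module l k \<Longrightarrow> (x + x', y + y') \<in> dwork_module l k"
proof (induction k arbitrary: l x y x' y')
  case (Suc k)
  obtain a u v where 1: "x = a * (\<sigma> ^^ l) (T l (Suc k)) + of_nat p * u"
    "y = a * (\<sigma> ^^ l) (T l k) + of_nat p * v" "(u, v) \<in> dwork_module (Suc l) k"
    using Suc.prems(1) by auto
  obtain a' u' v' where 2: "x' = a' * (\<sigma> ^^ l) (T l (Suc k)) + of_nat p * u'"
    "y' = a' * (\<sigma> ^^ l) (T l k) + of_nat p * v'" "(u', v') \<in> dwork_module (Suc l) k"
    using Suc.prems(2) by auto
  show ?case unfolding dwork_module.simps mem_Collect_eq
    by (rule exI[of _ "a + a'"], rule exI[of _ "u + u'"], rule exI[of _ "v + v'"])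
      (use 1 2 Suc.IH[OF 1(3) 2(3)] in \<open>simp add: algebra_simps\<close>)
qed simp

lemma dwork_module_scale:
  "(x, y) \<in> dwork_module l k \<Longrightarrow> (c * x, c * y) \<in> dwork_module l k"
proof (induction k arbitrary: l x y)
  case (Suc k)
  obtain a u v where 1: "x = a * (\<sigma> ^^ l) (T l (Suc k)) + of_nat p * u"
    "y = a * (\<sigma> ^^ l) (T l k) + of_nat p * v" "(u, v) \<in> dwork_module (Suc l) k"
    using Suc.prems by auto
  show ?case unfolding dwork_module.simps mem_Collect_eq
    by (rule exI[of _ "c * a"], rule exI[of _ "c * u"], rule exI[of _ "c * v"])
      (use 1 Suc.IH[OF 1(3)] in \<open>simp add: algebra_simps\<close>)
qed simp

lemma zero_in_dwork_module: "(0, 0) \<in> dwork_module l k"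
proof (induction k arbitrary: l)
  case (Suc k)
  show ?case unfolding dwork_module.simps mem_Collect_eq
    by (rule exI[of _ 0], rule exI[of _ 0], rule exI[of _ 0]) (simp add: Suc)
qed simp

lemma p_mult_in_dwork_module:
  assumes "(x, y) \<in> dwork_module (Suc l) k"
  shows "(of_nat p * x, of_nat p * y) \<in> dwork_module l (Suc k)"
  unfolding dwork_module.simps mem_Collect_eq
  by (rule exI[of _ 0], rule exI[of _ x], rule exI[of _ y]) (simp add: assms)

lemma generator_in_dwork_module:
  "(a * (\<sigma> ^^ l) (T l (Suc k)), a * (\<sigma> ^^ l) (T l k)) \<in> dwork_module l (Suc k)"
  unfolding dwork_module.simps mem_Collect_eq
  by (rule exI[of _ a], rule exI[of _ 0], rule exI[of _ 0]) (simp add: zero_in_dwork_module)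

text \<open>
  The two extraction exponents differ because the block of the first component is one factor longer.
\<close>
definition coeff_pair :: "nat \<Rightarrow> nat \<Rightarrow> 'a poly \<Rightarrow> 'a poly \<Rightarrow> 'a \<times> 'a" where
  "coeff_pair l k F G =
     (Polynomial.coeff F (p ^ (l + Suc k) - 1), Polynomial.coeff G (p ^ (l + k) - 1))"

lemma coeff_pair_add:
  assumes "coeff_pair l k F G \<in> dwork_module m n" and "coeff_pair l k F' G' \<in> dwork_module m n"
  shows "coeff_pair l k (F + F') (G + G') \<in> dwork_module m n"
  using dwork_module_add[OF assms[unfolded coeff_pair_def]] by (simp add: coeff_pair_def)

text \<open>
  The difference between a power with exponent \<open>p ^ Suc j\<close> and what it would be if \<open>\<phi>\<close> were exactly the
  \<open>p\<close>-th power map; it is divisible by \<open>p ^ Suc j\<close>.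
\<close>
definition ghost :: "nat \<Rightarrow> 'a poly \<Rightarrow> 'a poly" where
  "ghost j F = F ^ p ^ Suc j - \<phi> F ^ p ^ j"

lemma ghost_eq_p_power_mult:
  obtains G where "ghost j F = of_nat (p ^ Suc j) * G"
    and "Polynomial.degree G \<le> p ^ Suc j * Polynomial.degree F"
proof -
  interpret E: frobenius_lift \<phi> p by (rule frobenius_lift_frob_ext)
  have "of_nat p dvd F ^ p - \<phi> F" 
    using E.frob[of F] dvd_minus_iff[of "of_nat p" "\<phi> F - F ^ p"] by (simp only: minus_diff_eq)
  from dvd_power_p_power_diff[OF prime_p this, of j]
  have "of_nat (p ^ Suc j) dvd ghost j F"
    unfolding ghost_def power_mult[symmetric] power_Suc[symmetric] of_nat_power .
  then obtain G where G: "ghost j F = of_nat (p ^ Suc j) * G" by blast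
  have p: "p > 0" using prime_p prime_gt_0_nat by blast
  have "of_nat (p ^ Suc j) * G = Polynomial.smult (of_nat (p ^ Suc j)) G"
    by (rule of_nat_mult_conv_smult)
  moreover have "(of_nat (p ^ Suc j) :: 'a) \<noteq> 0" using p by (simp only: of_nat_eq_0_iff) simp
  ultimately have "Polynomial.degree G = Polynomial.degree (ghost j F)"
    unfolding G by (simp only: degree_smult_eq if_False)
  also have "\<dots> \<le> p ^ Suc j * Polynomial.degree F"
    unfolding ghost_def
  proof (rule degree_diff_le)
    show "Polynomial.degree (F ^ p ^ Suc j) \<le> p ^ Suc j * Polynomial.degree F"
      using degree_power_le[of F "p ^ Suc j"] by (simp add: mult.commute)
    have "Polynomial.degree (\<phi> F ^ p ^ j) \<le> Polynomial.degree (\<phi> F) * p ^ j"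
      by (rule degree_power_le)
    also have "\<dots> \<le> (p * Polynomial.degree F) * p ^ j"
      using degree_frob_ext_le by (rule mult_le_mono1)
    finally show "Polynomial.degree (\<phi> F ^ p ^ j) \<le> p ^ Suc j * Polynomial.degree F"
      by (simp add: mult.commute mult.left_commute)
  qed
  finally show thesis using that G by blast
qed

lemma coeff_pair_of_nat_mult:
  "coeff_pair l k (of_nat c * F) (of_nat c * G) =
     (of_nat c * fst (coeff_pair l k F G), of_nat c * snd (coeff_pair l k F G))"
  by (simp add: coeff_pair_def of_nat_poly)

definition scaled_module :: "nat \<Rightarrow> nat \<Rightarrow> nat \<Rightarrow> ('a \<times> 'a) set" where
  "scaled_module n l k = (\<lambda>(x, y). (of_nat (p ^ n) * x, of_nat (p ^ n) * y)) ` dwork_module l k"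

lemma scaled_module_add:
  assumes "u \<in> scaled_module n l k" and "v \<in> scaled_module n l k"
  shows "(fst u + fst v, snd u + snd v) \<in> scaled_module n l k"
proof -
  obtain x y where u: "u = (of_nat (p ^ n) * x, of_nat (p ^ n) * y)" "(x, y) \<in> dwork_module l k"
    using assms(1) by (auto simp: scaled_module_def)
  obtain x' y' where v: "v = (of_nat (p ^ n) * x', of_nat (p ^ n) * y')" "(x', y') \<in> dwork_module l k"
    using assms(2) by (auto simp: scaled_module_def)
  show ?thesis unfolding scaled_module_def
    by (rule image_eqI[OF _ dwork_module_add[OF u(2) v(2)]]) (simp add: u(1) v(1) distrib_left)
qed

lemma scaled_module_intro:
  "u \<in> dwork_module l k \<Longrightarrow> (of_nat (p ^ n) * fst u, of_nat (p ^ n) * snd u) \<in> scaled_module n l k"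
  unfolding scaled_module_def by (rule image_eqI[of _ _ u]) (simp_all add: split_beta)

lemma scaled_module_Suc_subset: "scaled_module (Suc n) (Suc l) k \<subseteq> scaled_module n l (Suc k)"
proof
  fix u assume "u \<in> scaled_module (Suc n) (Suc l) k"
  then obtain x y where u: "u = (of_nat (p ^ Suc n) * x, of_nat (p ^ Suc n) * y)"
    "(x, y) \<in> dwork_module (Suc l) k" by (auto simp: scaled_module_def)
  show "u \<in> scaled_module n l (Suc k)" unfolding scaled_module_def
    by (rule image_eqI[OF _ p_mult_in_dwork_module[OF u(2)]]) (simp add: u(1) algebra_simps)
qed

lemma scaled_module_subset: "scaled_module n l k \<subseteq> dwork_module l k"
  by (auto simp: scaled_module_def intro: dwork_module_scale)

text \<open>
  Replacing one \<open>p\<close>-th power after another by \<open>\<phi>\<close> turns \<open>(\<phi> ^^ i) (F ^ p ^ j)\<close> into \<open>(\<phi> ^^ (i + j)) F\<close>, whose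
  contribution factors and is a multiple of the generator, plus ghost terms, which lie in \<open>p\<close> times the
  next module.
\<close>
lemma coeff_pair_in_dwork_module_if_ghost:
  assumes ghost: "\<And>i j Q. Polynomial.degree Q \<le> 2 * (p ^ (i + Suc j) - 1) \<Longrightarrow>
      coeff_pair (i + Suc j) k (Q * (\<phi> ^^ i) (ghost j (W (i + Suc j) (Suc k))))
        (Q * (\<phi> ^^ i) (ghost j (W (i + Suc j) k)))
      \<in> scaled_module (Suc j) (Suc (i + Suc j)) k"
    and deg: "Polynomial.degree Q \<le> 2 * (p ^ (i + j) - 1)"
  shows "coeff_pair (i + j) k (Q * (\<phi> ^^ i) (W (i + j) (Suc k) ^ p ^ j))
     (Q * (\<phi> ^^ i) (W (i + j) k ^ p ^ j)) \<in> dwork_module (i + j) (Suc k)"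
  using deg
proof (induction j arbitrary: i)
  case 0
  then have "coeff_pair i k (Q * (\<phi> ^^ i) (W i (Suc k))) (Q * (\<phi> ^^ i) (W i k)) =
    (Polynomial.coeff Q (p ^ i - 1) * (\<sigma> ^^ i) (T i (Suc k)),
     Polynomial.coeff Q (p ^ i - 1) * (\<sigma> ^^ i) (T i k))"
    unfolding coeff_pair_def dwork_coeff_def
    using coeff_mult_funpow_frob_ext[of Q i _ "Suc k"] coeff_mult_funpow_frob_ext[of Q i _ k] by simp
  then show ?case
    using generator_in_dwork_module[of "Polynomial.coeff Q (p ^ i - 1)" i k] by simp
next
  case (Suc j)
  let ?l = "i + Suc j"
  interpret M: comm_ring_morphism "\<phi> ^^ i" by (rule funpow_frob_ext_morphism)
  interpret E: comm_ring_morphism \<phi> by (rule frob_ext_morphism)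
  have split: "Q * (\<phi> ^^ i) (F ^ p ^ Suc j) =
      Q * (\<phi> ^^ i) (ghost j F) + Q * (\<phi> ^^ Suc i) (F ^ p ^ j)" for F
    by (simp add: ghost_def M.diff E.power funpow_swap1 algebra_simps)
  have "coeff_pair ?l k (Q * (\<phi> ^^ i) (ghost j (W ?l (Suc k)))) (Q * (\<phi> ^^ i) (ghost j (W ?l k)))
      \<in> scaled_module (Suc j) (Suc ?l) k"
    using Suc.prems by (rule ghost)
  also have "scaled_module (Suc j) (Suc ?l) k \<subseteq> dwork_module ?l (Suc k)"
    using scaled_module_Suc_subset scaled_module_subset by blast
  finally have 1: "coeff_pair ?l k (Q * (\<phi> ^^ i) (ghost j (W ?l (Suc k))))
      (Q * (\<phi> ^^ i) (ghost j (W ?l k))) \<in> dwork_module ?l (Suc k)" .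
  have 2: "coeff_pair ?l k (Q * (\<phi> ^^ Suc i) (W ?l (Suc k) ^ p ^ j))
      (Q * (\<phi> ^^ Suc i) (W ?l k ^ p ^ j)) \<in> dwork_module ?l (Suc k)"
    using Suc.IH[of "Suc i"] Suc.prems by simp
  show ?case unfolding split by (rule coeff_pair_add[OF 1 2])
qed

lemma degree_mult_funpow_frob_ext_le:
  assumes "Polynomial.degree Q \<le> 2 * (p ^ (i + Suc j) - 1)"
    and "Polynomial.degree G \<le> p ^ Suc j * (2 * (p - 1))"
  shows "Polynomial.degree (Q * (\<phi> ^^ i) G) \<le> 2 * (p ^ Suc (i + Suc j) - 1)"
proof -
  have p: "p > 0" using prime_p prime_gt_0_nat by blast
  have "Polynomial.degree ((\<phi> ^^ i) G) \<le> p ^ i * Polynomial.degree G"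
    by (rule degree_funpow_frob_ext_le)
  also have "\<dots> \<le> p ^ i * (p ^ Suc j * (2 * (p - 1)))" using assms(2) by simp
  also have "\<dots> = 2 * (p ^ (i + Suc j) * (p - 1))" by (simp add: power_add mult_ac)
  finally have "Polynomial.degree (Q * (\<phi> ^^ i) G) \<le>
      2 * (p ^ (i + Suc j) - 1) + 2 * (p ^ (i + Suc j) * (p - 1))"
    using assms(1) degree_mult_le[of Q "(\<phi> ^^ i) G"] by linarith
  also have "\<dots> = 2 * ((p ^ (i + Suc j) - 1) + p ^ (i + Suc j) * (p - 1))" by simp
  also have "(p ^ (i + Suc j) - 1) + p ^ (i + Suc j) * (p - 1) = p ^ Suc (i + Suc j) - 1"
  proof -
    have "p ^ (i + Suc j) \<ge> 1" using p by simp
    moreover have "p ^ Suc (i + Suc j) = p ^ (i + Suc j) + p ^ (i + Suc j) * (p - 1)"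
      using p by (cases p) (simp_all del: power_Suc power.simps add: power_Suc2 mult.commute)
    ultimately show ?thesis by linarith
  qed
  finally show ?thesis .
qed

text \<open>
  Since \<open>W l (Suc n) = \<Lambda> l * W (Suc l) n ^ p\<close>, this expresses the ghost terms of a block by those of its
  first factor and of the remaining block. The first summand is divisible by \<open>p ^ Suc j\<close>, the second
  one is a multiple of a ghost term with a larger \<open>j\<close>.
\<close>
lemma ghost_mult_power: "ghost j (L * Y ^ p) =
    ghost j L * Y ^ p ^ Suc (Suc j) + \<phi> L ^ p ^ j * ghost (Suc j) Y"
proof -
  interpret E: comm_ring_morphism \<phi> by (rule frob_ext_morphism)
  have telescope: "a * b - c * d = (a - c) * b + c * (b - d)" for a b c d :: "'a poly"
    by (simp add: algebra_simps)
  show ?thesis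
    unfolding ghost_def E.mult E.power power_mult_distrib power_mult[symmetric] power_Suc[symmetric]
    by (rule telescope)
qed

text \<open>
  Induction on the length of the block, with the decomposition \<open>ghost_mult_power\<close>. In both summands the
  known factors are absorbed into \<open>Q\<close>; the bound on its degree grows in step with \<open>l\<close>, because the
  factors have degree at most \<open>2 (p - 1)\<close>.
\<close>
lemma coeff_pair_ghost:
  assumes "Polynomial.degree Q \<le> 2 * (p ^ (i + Suc j) - 1)"
  shows "coeff_pair (i + Suc j) k (Q * (\<phi> ^^ i) (ghost j (W (i + Suc j) (Suc k))))
        (Q * (\<phi> ^^ i) (ghost j (W (i + Suc j) k)))
      \<in> scaled_module (Suc j) (Suc (i + Suc j)) k"
  using assms
proof (induction k arbitrary: i j Q)
  case 0
  let ?l = "i + Suc j"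
  interpret M: comm_ring_morphism "\<phi> ^^ i" by (rule funpow_frob_ext_morphism)
  interpret E: comm_ring_morphism \<phi> by (rule frob_ext_morphism)
  obtain G where G: "ghost j (\<Lambda> ?l) = of_nat (p ^ Suc j) * G"
    by (rule ghost_eq_p_power_mult)
  have "Q * (\<phi> ^^ i) (ghost j (W ?l (Suc 0))) = of_nat (p ^ Suc j) * (Q * (\<phi> ^^ i) G)"
    by (simp only: W_Suc dwork_prod_0 power_one mult_1_right G M.mult M.of_nat mult.left_commute)
  moreover have "Q * (\<phi> ^^ i) (ghost j (W ?l 0)) = of_nat (p ^ Suc j) * 0"
    by (simp add: ghost_def E.one M.zero)
  moreover have "coeff_pair ?l 0 (Q * (\<phi> ^^ i) G) 0 \<in> dwork_module (Suc ?l) 0"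
    by (simp add: coeff_pair_def)
  ultimately show ?case
    by (simp only: coeff_pair_of_nat_mult scaled_module_intro)
next
  case (Suc k)
  let ?l = "i + Suc j"
  interpret M: comm_ring_morphism "\<phi> ^^ i" by (rule funpow_frob_ext_morphism)
  obtain G where G: "ghost j (\<Lambda> ?l) = of_nat (p ^ Suc j) * G"
    and degG: "Polynomial.degree G \<le> p ^ Suc j * Polynomial.degree (\<Lambda> ?l)"
    by (rule ghost_eq_p_power_mult)
  let ?Q1 = "Q * (\<phi> ^^ i) G" and ?Q2 = "Q * (\<phi> ^^ i) (\<phi> (\<Lambda> ?l) ^ p ^ j)"
  have degG': "Polynomial.degree G \<le> p ^ Suc j * (2 * (p - 1))"
    using order_trans[OF degG mult_le_mono2[OF degree_le]] .
  have "Polynomial.degree (\<phi> (\<Lambda> ?l) ^ p ^ j) \<le> Polynomial.degree (\<phi> (\<Lambda> ?l)) * p ^ j"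
    by (rule degree_power_le)
  also have "\<dots> \<le> (p * (2 * (p - 1))) * p ^ j"
    by (rule mult_le_mono1[OF order_trans[OF degree_frob_ext_le mult_le_mono2[OF degree_le]]])
  finally have degL: "Polynomial.degree (\<phi> (\<Lambda> ?l) ^ p ^ j) \<le> p ^ Suc j * (2 * (p - 1))"
    by (simp add: mult_ac)
  have split: "Q * (\<phi> ^^ i) (ghost j (W ?l (Suc n))) =
      of_nat (p ^ Suc j) * (?Q1 * (\<phi> ^^ i) (W (Suc ?l) n ^ p ^ Suc (Suc j)))
      + ?Q2 * (\<phi> ^^ i) (ghost (Suc j) (W (Suc ?l) n))" for n
    by (simp only: W_Suc ghost_mult_power G M.add M.mult M.of_nat distrib_left mult.assoc
        mult.left_commute[of Q])
  have "coeff_pair (Suc ?l) k (?Q1 * (\<phi> ^^ i) (W (Suc ?l) (Suc k) ^ p ^ Suc (Suc j)))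
     (?Q1 * (\<phi> ^^ i) (W (Suc ?l) k ^ p ^ Suc (Suc j))) \<in> dwork_module (Suc ?l) (Suc k)"
    using coeff_pair_in_dwork_module_if_ghost[OF Suc.IH, of ?Q1 i "Suc (Suc j)"]
      degree_mult_funpow_frob_ext_le[OF Suc.prems degG'] by simp
  then have 1: "coeff_pair (Suc ?l) k
     (of_nat (p ^ Suc j) * (?Q1 * (\<phi> ^^ i) (W (Suc ?l) (Suc k) ^ p ^ Suc (Suc j))))
     (of_nat (p ^ Suc j) * (?Q1 * (\<phi> ^^ i) (W (Suc ?l) k ^ p ^ Suc (Suc j))))
     \<in> scaled_module (Suc j) (Suc ?l) (Suc k)"
    unfolding coeff_pair_of_nat_mult by (rule scaled_module_intro)
  have "coeff_pair (Suc ?l) k (?Q2 * (\<phi> ^^ i) (ghost (Suc j) (W (Suc ?l) (Suc k))))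
     (?Q2 * (\<phi> ^^ i) (ghost (Suc j) (W (Suc ?l) k)))
     \<in> scaled_module (Suc (Suc j)) (Suc (Suc ?l)) k"
    using Suc.IH[of ?Q2 i "Suc j"] degree_mult_funpow_frob_ext_le[OF Suc.prems degL] by simp
  also have "\<dots> \<subseteq> scaled_module (Suc j) (Suc ?l) (Suc k)"
    by (rule scaled_module_Suc_subset)
  finally have 2: "coeff_pair (Suc ?l) k (?Q2 * (\<phi> ^^ i) (ghost (Suc j) (W (Suc ?l) (Suc k))))
     (?Q2 * (\<phi> ^^ i) (ghost (Suc j) (W (Suc ?l) k))) \<in> scaled_module (Suc j) (Suc ?l) (Suc k)" .
  show ?case unfolding split
    using scaled_module_add[OF 1 2] by (simp add: coeff_pair_def)
qed

lemmas coeff_pair_in_dwork_module = coeff_pair_in_dwork_module_if_ghost[OF coeff_pair_ghost]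

text \<open>
  The generator of one module lies already in the next one, because
  \<open>W l (Suc n) = \<Lambda> l * W (Suc l) n ^ p\<close>. The factor \<open>t ^ (p ^ l - 1)\<close> in the proof picks out the
  coefficients after an application of \<open>\<phi> ^^ l\<close>.
\<close>
lemma T_in_dwork_module:
  "((\<sigma> ^^ l) (T l (Suc (Suc k))), (\<sigma> ^^ l) (T l (Suc k))) \<in> dwork_module (Suc l) (Suc k)"
proof -
  have p: "p > 0" using prime_p prime_gt_0_nat by blast
  interpret M: comm_ring_morphism "\<phi> ^^ l" by (rule funpow_frob_ext_morphism)
  let ?X = "Polynomial.monom 1 (p ^ l - 1) :: 'a poly"
  let ?Q = "?X * (\<phi> ^^ l) (\<Lambda> l)"
  have degX: "Polynomial.degree ?X \<le> p ^ l - 1" by (rule degree_monom_le)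
  have "(\<sigma> ^^ l) (T l n) = Polynomial.coeff (?X * (\<phi> ^^ l) (W l n)) (p ^ (l + n) - 1)" for n
    using degX by (subst coeff_mult_funpow_frob_ext) (simp_all add: dwork_coeff_def)
  then have "((\<sigma> ^^ l) (T l (Suc (Suc k))), (\<sigma> ^^ l) (T l (Suc k))) =
     coeff_pair (l + 1) k (?Q * (\<phi> ^^ l) (W (l + 1) (Suc k) ^ p ^ 1)) (?Q * (\<phi> ^^ l) (W (l + 1) k ^ p ^ 1))"
    unfolding coeff_pair_def by (simp add: W_Suc M.mult mult.assoc)
  also have "\<dots> \<in> dwork_module (l + 1) (Suc k)"
  proof (rule coeff_pair_in_dwork_module)
    have "Polynomial.degree ?Q \<le> (p ^ l - 1) + p ^ l * (2 * (p - 1))"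
    proof (rule order_trans[OF degree_mult_le add_mono[OF degX]])
      show "Polynomial.degree ((\<phi> ^^ l) (\<Lambda> l)) \<le> p ^ l * (2 * (p - 1))"
        by (rule order_trans[OF degree_funpow_frob_ext_le mult_le_mono2[OF degree_le]])
    qed
    also have "\<dots> \<le> 2 * ((p ^ l - 1) + p ^ l * (p - 1))" by simp
    also have "(p ^ l - 1) + p ^ l * (p - 1) = p ^ (l + 1) - 1"
    proof -
      have "p ^ l \<ge> 1" using p by simp
      moreover have "p ^ (l + 1) = p ^ l + p ^ l * (p - 1)"
        using p by (cases p) simp_all
      ultimately show ?thesis by linarith
    qed
    finally show "Polynomial.degree ?Q \<le> 2 * (p ^ (l + 1) - 1)" .
  qed
  finally show ?thesis by simp
qed

text \<open>
  Expand both rows along the generator. The terms without a factor \<open>p\<close> cancel, and the generator, like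
  the two remainders, lies in the next module; so each step of the recursion gains a factor \<open>p\<close>.
\<close>
lemma dwork_module_determinant:
  assumes "(x, y) \<in> dwork_module l (Suc k)" and "(x', y') \<in> dwork_module l (Suc k)"
  shows "of_nat p ^ Suc k dvd x * y' - x' * y"
  using assms
proof (induction k arbitrary: l x y x' y')
  case 0
  then obtain a u a' u' where
    "x = a * (\<sigma> ^^ l) (T l 1) + of_nat p * u" "y = a * (\<sigma> ^^ l) (T l 0)"
    "x' = a' * (\<sigma> ^^ l) (T l 1) + of_nat p * u'" "y' = a' * (\<sigma> ^^ l) (T l 0)"
    by auto
  then have "x * y' - x' * y = of_nat p * ((u * a' - u' * a) * (\<sigma> ^^ l) (T l 0))"
    by (simp add: algebra_simps)
  then show ?case by simp
next
  case (Suc k)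
  let ?A = "(\<sigma> ^^ l) (T l (Suc (Suc k)))" and ?B = "(\<sigma> ^^ l) (T l (Suc k))"
  obtain a u v where 1: "x = a * ?A + of_nat p * u" "y = a * ?B + of_nat p * v"
    and uv: "(u, v) \<in> dwork_module (Suc l) (Suc k)" using Suc.prems(1)
    unfolding dwork_module.simps(2)[of l "Suc k"] by blast
  obtain a' u' v' where 2: "x' = a' * ?A + of_nat p * u'" "y' = a' * ?B + of_nat p * v'"
    and uv': "(u', v') \<in> dwork_module (Suc l) (Suc k)" using Suc.prems(2)
    unfolding dwork_module.simps(2)[of l "Suc k"] by blast
  have "x * y' - x' * y = of_nat p * (a * (?A * v' - u' * ?B) + a' * (u * ?B - ?A * v)
     + of_nat p * (u * v' - u' * v))"
    unfolding 1 2 by (simp add: algebra_simps)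
  moreover have "of_nat p ^ Suc k dvd a * (?A * v' - u' * ?B) + a' * (u * ?B - ?A * v)
     + of_nat p * (u * v' - u' * v)"
    using Suc.IH[OF T_in_dwork_module uv'] Suc.IH[OF uv T_in_dwork_module] Suc.IH[OF uv uv']
    by (intro dvd_add dvd_mult)
  ultimately show ?case by (simp only: power_Suc) (rule mult_dvd_mono, simp_all)
qed

theorem dwork_congruence:
  "of_nat p ^ Suc k dvd T 0 (Suc (Suc k)) * \<sigma> (T 1 k) - \<sigma> (T 1 (Suc k)) * T 0 (Suc k)"
proof -
  have "(\<sigma> (T 1 (Suc k)), \<sigma> (T 1 k)) \<in> dwork_module (Suc 0) (Suc k)"
    using generator_in_dwork_module[of 1 1 k] by (simp del: dwork_module.simps)
  from dwork_module_determinant[OF T_in_dwork_module[of 0 k] this] show ?thesis by simp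
qed

end

section \<open>Congruences for logarithmic derivatives\<close>

locale derivation =
  fixes D :: "'a::comm_ring_1 \<Rightarrow> 'a"
  assumes add: "D (x + y) = D x + D y"
    and mult: "D (x * y) = D x * y + x * D y"
begin

lemma zero: "D 0 = 0"
  using add[of 0 0] by simp

lemma one: "D 1 = 0"
  using mult[of 1 1] by simp

lemma uminus: "D (- x) = - D x"
  using add[of x "- x"] zero by (simp add: eq_neg_iff_add_eq_0 add.commute)

lemma diff: "D (x - y) = D x - D y"
  using add[of x "- y"] uminus[of y] by simp

lemma of_nat: "D (of_nat n) = 0"
  by (induction n) (simp_all add: zero one add)

lemma of_int: "D (of_int n) = 0"
  by (cases n rule: int_cases2) (simp_all add: of_nat uminus)

lemma power: "D (x ^ n) = of_nat n * x ^ (n - 1) * D x"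
proof (induction n)
  case (Suc n)
  then show ?case by (cases n) (simp_all add: mult algebra_simps)
qed (simp add: one)

lemma map_poly_derivation: "derivation (map_poly D)"
proof
  have add': "map_poly D (f + g) = map_poly D f + map_poly D g" for f g
    by (intro poly_eqI) (simp add: coeff_map_poly zero add)
  then show "map_poly D (f + g) = map_poly D f + map_poly D g" for f g .
  have smult': "map_poly D (Polynomial.smult c g) = Polynomial.smult (D c) g + Polynomial.smult c (map_poly D g)" for c g
    by (intro poly_eqI) (simp add: coeff_map_poly zero mult)
  show "map_poly D (f * g) = map_poly D f * g + f * map_poly D g" for f g
  proof (induction f)
    case (pCons c f)
    have "map_poly D (pCons 0 (f * g)) = pCons 0 (map_poly D (f * g))"
      by (simp add: map_poly_pCons zero)
    then show ?case using pCons
      by (simp add: map_poly_pCons zero add' smult' algebra_simps)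
  qed simp
qed

end

lemma derivation_pderiv: "derivation (pderiv :: 'a::idom poly \<Rightarrow> 'a poly)"
  by unfold_locales (simp_all add: pderiv_add pderiv_mult algebra_simps)

lemma prime_elem_power_dvd_mult_cancel:
  fixes q :: "'a::idom"
  assumes "prime_elem q" and "\<not> q dvd c" and "q ^ n dvd c * x"
  shows "q ^ n dvd x"
  using assms(3)
proof (induction n)
  case (Suc n)
  have "q ^ n dvd c * x" using Suc.prems by (metis dvd_mult_left power_Suc2)
  then obtain y where y: "x = q ^ n * y" using Suc.IH by (auto simp: dvd_def)
  have "q ^ n * q dvd q ^ n * (c * y)"
    using Suc.prems by (simp add: y power_Suc2 mult.left_commute del: power_Suc)
  moreover have "q ^ n \<noteq> 0" using assms(1) by (simp add: prime_elem_def)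
  ultimately have "q dvd c * y" by (simp only: dvd_mult_cancel_left) simp
  then have "q dvd y" using assms(1,2) by (simp add: prime_elem_dvd_mult_iff)
  then show ?case by (auto simp: y power_Suc2 simp del: power_Suc)
qed simp

text \<open>
  The Dwork congruence expresses the difference of the logarithmic derivatives for \<open>n + 1\<close> and \<open>n\<close>
  by the same difference for the images under \<open>\<sigma>\<close> of the coefficients of the shifted sequence, with \<open>n\<close>
  and \<open>n - 1\<close> factors. The hypothesis on \<open>D (\<sigma> x)\<close>, a chain rule, provides the factor \<open>p\<close> that
  the induction needs.
\<close>
lemma dwork_log_derivative_congruence:
  fixes \<sigma> D :: "'a::{idom, ring_char_0} \<Rightarrow> 'a"
  assumes "frobenius_lift \<sigma> p" and "derivation D"
    and chain: "\<And>x. D (\<sigma> x) = of_nat p * m * \<sigma> (D x)"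
    and prime: "prime_elem (of_nat p :: 'a)"
    and "\<And>i. Polynomial.degree (\<Lambda> i) \<le> 2 * (p - 1)"
    and "\<And>l n. \<not> of_nat p dvd dwork_coeff p (\<lambda>i. \<Lambda> (l + i)) n"
  shows "of_nat p ^ n dvd D (dwork_coeff p \<Lambda> (Suc n)) * dwork_coeff p \<Lambda> n
    - D (dwork_coeff p \<Lambda> n) * dwork_coeff p \<Lambda> (Suc n)"
  using assms(5,6)
proof (induction n arbitrary: \<Lambda>)
  case (Suc k)
  interpret dwork_sequence \<sigma> p \<Lambda>
    using assms(1) Suc.prems(1) by (simp add: dwork_sequence_def dwork_sequence_axioms_def)
  interpret D: derivation D by fact
  define P where "P = (of_nat p ^ Suc k :: 'a)"
  define A B C E where "A = T 0 (Suc (Suc k))" and "B = T 0 (Suc k)"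
    and "C = \<sigma> (T 1 (Suc k))" and "E = \<sigma> (T 1 k)"
  have DP: "D P = 0" using D.of_nat[of "p ^ Suc k"] by (simp add: P_def)
  obtain R where R: "A * E = C * B + P * R"
    using dwork_congruence[of k] unfolding A_def B_def C_def E_def P_def
    by (auto simp: dvd_def algebra_simps)
  have "D A * E + A * D E = D C * B + C * D B + P * D R"
    using arg_cong[OF R, of D] by (simp add: D.mult D.add DP)
  then have DA: "D A * E = D C * B + C * D B + P * D R - A * D E"
    by (simp add: algebra_simps)
  \<comment> \<open>\<open>C * E\<close> is prime to \<open>p\<close> and can be cancelled in the end.\<close>
  have "C * E * (D A * B - D B * A) = C * B * (D A * E) - C * D B * (A * E)"
    by (simp add: algebra_simps)
  also have "\<dots> = D C * B * (C * B) - C * B * A * D E + P * (C * B * D R - C * D B * R)"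
    unfolding DA R by (simp add: algebra_simps)
  also have "D C * B * (C * B) = D C * B * (A * E) - P * (D C * B * R)"
    unfolding R by (simp add: algebra_simps)
  also have "D C * B * (A * E) - P * (D C * B * R) - C * B * A * D E + P * (C * B * D R - C * D B * R)
      = A * B * (D C * E - D E * C) + P * (C * B * D R - C * D B * R - D C * B * R)"
    by (simp add: algebra_simps)
  finally have eq: "C * E * (D A * B - D B * A) =
    A * B * (D C * E - D E * C) + P * (C * B * D R - C * D B * R - D C * B * R)" .
  have "of_nat p ^ k dvd D (T 1 (Suc k)) * T 1 k - D (T 1 k) * T 1 (Suc k)"
  proof (rule Suc.IH)
    show "\<not> of_nat p dvd dwork_coeff p (\<lambda>i. \<Lambda> (1 + (l + i))) n" for l n
      using Suc.prems(2)[where l = "1 + l" and n = n] unfolding add.assoc .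
  qed (rule Suc.prems(1))
  then have "of_nat p ^ k dvd \<sigma> (D (T 1 (Suc k)) * T 1 k - D (T 1 k) * T 1 (Suc k))"
    using dvd power of_nat by metis
  then have "of_nat p * of_nat p ^ k dvd of_nat p * (m * \<sigma> (D (T 1 (Suc k)) * T 1 k - D (T 1 k) * T 1 (Suc k)))"
    by (intro mult_dvd_mono dvd_mult) simp_all
  also have "\<dots> = D C * E - D E * C"
    by (simp add: C_def E_def chain diff mult algebra_simps)
  finally have "P dvd D C * E - D E * C" by (simp add: P_def)
  then have *: "P dvd C * E * (D A * B - D B * A)" unfolding eq by simp
  have "\<not> of_nat p dvd \<sigma> (T 1 n)" for n
  proof
    assume "of_nat p dvd \<sigma> (T 1 n)"
    moreover have "of_nat p dvd \<sigma> (T 1 n) - T 1 n ^ p" by (rule frob)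
    ultimately have "of_nat p dvd T 1 n ^ p" by (metis dvd_diff diff_diff_eq2 add_diff_cancel_left')
    then have "of_nat p dvd T 1 n" using prime prime_elem_dvd_power by blast
    then show False using Suc.prems(2) by blast
  qed
  then have "\<not> of_nat p dvd C * E"
    using prime by (simp add: C_def E_def prime_elem_dvd_mult_iff)
  from prime_elem_power_dvd_mult_cancel[OF prime this *[unfolded P_def]]
  show ?case by (simp add: A_def B_def)
qed simp

section \<open>The ring of integer polynomials in two variables\<close>

text \<open>
  The ring is generated by the two variables, so that identities between homomorphisms or
  derivations need to be checked on constants and variables only.
\<close>
lemma int_poly_poly_induct [case_names of_int zvar add mult]:
  assumes of_int: "\<And>c. P (of_int c)" and zvar: "\<And>j. P (zvar j)"
    and add: "\<And>f g. P f \<Longrightarrow> P g \<Longrightarrow> P (f + g)"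
    and mult: "\<And>f g. P f \<Longrightarrow> P g \<Longrightarrow> P (f * g)"
  shows "P f"
proof (induction f)
  case 0
  then show ?case using of_int[of 0] by simp
next
  case (pCons g f)
  have "P [:g:]"
  proof (induction g)
    case 0
    then show ?case using of_int[of 0] by simp
  next
    case (pCons c g)
    have "[:pCons c g:] = of_int c + zvar 1 * [:g:]"
      by (simp add: zvar_def of_int_poly)
    then show ?case using pCons of_int zvar add mult by metis
  qed
  moreover have "pCons g f = [:g:] + zvar 2 * f" by (simp add: zvar_def)
  ultimately show ?case using pCons zvar add mult by metis
qed

lemma eval2_morphism: "comm_ring_morphism (\<lambda>f. eval2 f a)"
proof -
  interpret I: comm_ring_morphism "of_int :: int \<Rightarrow> 'a" by (rule comm_ring_morphism_of_int)
  have "(\<lambda>f. eval2 f a) = poly_lift (poly_lift of_int (a $ 1)) (a $ 2)"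
    by (simp add: fun_eq_iff eval2_def poly_lift_def[abs_def])
  then show ?thesis
    using comm_ring_morphism.morphism_poly_lift[OF I.morphism_poly_lift] by simp
qed

lemma eval2_zvar: "eval2 (zvar j) a = a $ j"
  using exhaust_2[of j] by (auto simp: eval2_def zvar_def map_poly_pCons)

lemma morphism_eval2:
  assumes "comm_ring_morphism h"
  shows "h (eval2 f a) = eval2 f (\<chi> k. h (a $ k))"
proof -
  interpret h: comm_ring_morphism h by fact
  interpret L: comm_ring_morphism "\<lambda>f. eval2 f a" by (rule eval2_morphism)
  interpret R: comm_ring_morphism "\<lambda>f. eval2 f (\<chi> k. h (a $ k))" by (rule eval2_morphism)
  show ?thesis
    by (induction f rule: int_poly_poly_induct)
      (simp_all add: L.of_int R.of_int h.of_int eval2_zvar L.add R.add h.add L.mult R.mult h.mult)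
qed

lemma derivation_pderiv2: "derivation (pderiv2 j)"
  using derivation.map_poly_derivation[OF derivation_pderiv, where 'a1 = int]
    derivation_pderiv[where 'a = "int poly"]
  by (cases "j = 1") (simp_all add: pderiv2_def[abs_def])

lemma pderiv2_zvar: "pderiv2 j (zvar k) = (if j = k then 1 else 0)"
  using exhaust_2[of j] exhaust_2[of k]
  by (auto simp: pderiv2_def zvar_def map_poly_pCons pderiv_pCons one_pCons)

text \<open>
  Fermat's little theorem, in the form needed for a Frobenius lift. Since \<open>p\<close> is odd, negative integers
  reduce to positive ones.
\<close>
lemma prime_dvd_power_diff_int:
  assumes "prime p" and "odd p"
  shows "int p dvd x - x ^ p"
proof -
  have nat: "int p dvd int n - int n ^ p" for n
  proof (induction n)
    case 0
    then show ?case using assms(1) by (simp add: prime_gt_0_nat power_0_left)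
  next
    case (Suc n)
    have "int p dvd (int n + 1) ^ p - (int n ^ p + 1 ^ p)"
      using dvd_power_add_diff[OF assms(1), of "int n" 1] by simp
    with Suc have "int p dvd (int n - int n ^ p) - ((int n + 1) ^ p - (int n ^ p + 1 ^ p))"
      by (rule dvd_diff)
    then show ?case by (simp add: algebra_simps)
  qed
  show ?thesis
  proof (cases "x \<ge> 0")
    case True
    then show ?thesis using nat[of "nat x"] by simp
  next
    case False
    then have "int p dvd - ((- x) - (- x) ^ p)"
      using nat[of "nat (- x)"] by (simp only: dvd_minus_iff) simp
    then show ?thesis using assms(2) by (simp add: algebra_simps)
  qed
qed

definition frob2 :: "nat \<Rightarrow> int poly poly \<Rightarrow> int poly poly" where
  "frob2 p = frob_ext p (frob_ext p (\<lambda>x. x))"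

lemma frobenius_lift_frob2:
  assumes "prime p" and "odd p"
  shows "frobenius_lift (frob2 p) p"
proof -
  have "frobenius_lift (\<lambda>x::int. x) p"
    using assms comm_ring_morphism_id prime_dvd_power_diff_int
    by (simp add: frobenius_lift_def frobenius_lift_axioms_def)
  then show ?thesis
    unfolding frob2_def by (intro frobenius_lift.frobenius_lift_frob_ext)
qed

lemma frob2_zvar:
  assumes "prime p" and "odd p"
  shows "frob2 p (zvar j) = zvar j ^ p"
proof -
  interpret F0: frobenius_lift "\<lambda>x::int. x" p
    using assms comm_ring_morphism_id prime_dvd_power_diff_int
    by (simp add: frobenius_lift_def frobenius_lift_axioms_def)
  interpret F1: frobenius_lift F0.\<phi> p by (rule F0.frobenius_lift_frob_ext)
  interpret F2: frobenius_lift F1.\<phi> p by (rule F1.frobenius_lift_frob_ext)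
  have 1: "F0.\<phi> [:0, 1:] = Polynomial.monom 1 p"
    using F0.frob_ext_pCons[of 0 1] F1.one by (simp add: one_pCons)
  have 2: "F1.\<phi> [:c:] = [:F0.\<phi> c:]" for c
    using F1.frob_ext_pCons[of c 0] F2.zero by simp
  have 3: "F1.\<phi> [:0, 1:] = Polynomial.monom 1 p"
    using F1.frob_ext_pCons[of 0 1] F2.one F1.zero by (simp add: one_pCons smult_monom)
  show ?thesis
    using exhaust_2[of j]
    by (auto simp: frob2_def zvar_def 1 2 3 monom_altdef poly_const_pow)
qed

text \<open>
  The chain rule for \<open>z\<^sub>j \<mapsto> z\<^sub>j\<^sup>p\<close>.
\<close>
lemma pderiv2_frob2:
  assumes "prime p" and "odd p"
  shows "pderiv2 j (frob2 p f) = of_nat p * zvar j ^ (p - 1) * frob2 p (pderiv2 j f)"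
proof -
  interpret D: derivation "pderiv2 j" by (rule derivation_pderiv2)
  interpret F: frobenius_lift "frob2 p" p by (rule frobenius_lift_frob2[OF assms])
  show ?thesis
  proof (induction f rule: int_poly_poly_induct)
    case (of_int c)
    then show ?case by (simp add: F.of_int D.of_int F.zero)
  next
    case (zvar k)
    then show ?case
      by (simp add: frob2_zvar[OF assms] D.power pderiv2_zvar F.one F.zero)
  next
    case (add f g)
    then show ?case by (simp add: F.add D.add algebra_simps)
  next
    case (mult f g)
    then show ?case by (simp add: F.add F.mult D.mult algebra_simps)
  qed
qed

lemma prime_elem_of_nat_poly_poly:
  assumes "prime p"
  shows "prime_elem (of_nat p :: int poly poly)"
  using assms by (simp add: of_nat_poly prime_elem_const_poly_iff)

section \<open>The master polynomials\<close>

definition digit_poly :: "nat \<Rightarrow> nat \<Rightarrow> int poly poly poly" where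
  "digit_poly p w = [:0, 1:] ^ w * t_minus_z 1 ^ ((p - 1) div 2) * t_minus_z 2 ^ ((p - 1) div 2)"

lemma degree_digit_poly_le:
  assumes "w \<le> p - 1"
  shows "Polynomial.degree (digit_poly p w) \<le> 2 * (p - 1)"
proof -
  let ?a = "(p - 1) div 2"
  have "Polynomial.degree ([:0, 1:] ^ w :: int poly poly poly) \<le> w"
    using degree_power_le[of "[:0, 1:] :: int poly poly poly" w] by simp
  moreover have "Polynomial.degree (t_minus_z j ^ ?a) \<le> ?a" for j
    using degree_power_le[of "t_minus_z j" ?a] by (simp add: t_minus_z_def)
  ultimately have "Polynomial.degree (digit_poly p w) \<le> w + ?a + ?a"
    unfolding digit_poly_def
    by (intro order_trans[OF degree_mult_le] add_mono) auto
  then show ?thesis using assms by simp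
qed

lemma sum_half_powers:
  assumes "odd (p::nat)"
  shows "(\<Sum>i<n. (p - 1) div 2 * p ^ i) = (p ^ n - 1) div 2"
proof -
  obtain q where q: "p = 2 * q + 1" using assms by (rule oddE)
  have "2 * (\<Sum>i<n. q * p ^ i) + 1 = p ^ n"
    by (induction n) (simp_all add: q algebra_simps)
  then show ?thesis by (simp add: q)
qed

lemma dwork_prod_digit_poly:
  assumes "odd p"
  shows "dwork_prod p (\<lambda>i. digit_poly p (w i)) n =
    [:0, 1:] ^ (\<Sum>i<n. w i * p ^ i) * t_minus_z 1 ^ ((p ^ n - 1) div 2)
      * t_minus_z 2 ^ ((p ^ n - 1) div 2)"
  unfolding dwork_prod_def digit_poly_def power_mult_distrib power_mult[symmetric] prod.distrib
    power_sum[symmetric] sum_half_powers[OF assms] by simp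

lemma Tpol_eq_dwork_coeff:
  assumes "odd p" and "nat ((int p ^ s - lam) div 2) = (\<Sum>i<s. w i * p ^ i)"
  shows "Tpol p s lam = dwork_coeff p (\<lambda>i. digit_poly p (w i)) s"
  by (simp add: Tpol_def Phi_def dwork_coeff_def dwork_prod_digit_poly[OF assms(1)] assms(2))

text \<open>
  The quotient of \<^const>\<open>Phi\<close> by \<open>t - z\<^sub>j\<close>.
\<close>
definition Phi_div :: "nat \<Rightarrow> nat \<Rightarrow> int \<Rightarrow> 2 \<Rightarrow> int poly poly poly" where
  "Phi_div p s lam j = [:0, 1:] ^ nat ((int p ^ s - lam) div 2)
     * t_minus_z 1 ^ ((p ^ s - 1) div 2 - (if j = 1 then 1 else 0))
     * t_minus_z 2 ^ ((p ^ s - 1) div 2 - (if j = 1 then 0 else 1))"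

context
  fixes p s a :: nat
  assumes a_def: "a = (p ^ s - 1) div 2" and a_pos: "a > 0"
begin

lemma Phi_eq_mult_Phi_div: "Phi p s lam = t_minus_z j * Phi_div p s lam j"
proof -
  obtain b where "a = Suc b" using a_pos gr0_conv_Suc by blast
  then show ?thesis using exhaust_2[of j]
    unfolding Phi_def Phi_div_def a_def[symmetric] by (auto simp: mult_ac)
qed

lemma Ivec_eq_coeff_Phi_div: "Ivec p s lam $ j = Polynomial.coeff (Phi_div p s lam j) (p ^ s - 1)"
proof -
  have "t_minus_z j \<noteq> 0" by (simp add: t_minus_z_def)
  then show ?thesis by (simp add: Ivec_def Phi_eq_mult_Phi_div[of lam j])
qed

lemma pderiv2_Tpol: "pderiv2 j (Tpol p s lam) = - (of_nat a * Ivec p s lam $ j)"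
proof -
  interpret D: derivation "pderiv2 j" by (rule derivation_pderiv2)
  interpret M: derivation "map_poly (pderiv2 j)" by (rule D.map_poly_derivation)
  have t: "map_poly (pderiv2 j) [:0, 1:] = 0"
    by (simp add: map_poly_pCons D.zero D.one)
  have z: "map_poly (pderiv2 j) (t_minus_z k) = (if j = k then - 1 else 0)" for k
    by (simp add: t_minus_z_def map_poly_pCons D.zero D.uminus D.one pderiv2_zvar) (simp add: one_pCons)
  have "map_poly (pderiv2 j) (Phi p s lam) = - (of_nat a * Phi_div p s lam j)"
    using exhaust_2[of j]
    unfolding Phi_def Phi_div_def a_def[symmetric] by (auto simp: M.mult M.power t z algebra_simps)
  moreover have "pderiv2 j (Tpol p s lam) = Polynomial.coeff (map_poly (pderiv2 j) (Phi p s lam)) (p ^ s - 1)"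
    by (simp add: Tpol_def coeff_map_poly D.zero)
  ultimately show ?thesis
    by (simp add: Ivec_eq_coeff_Phi_div of_nat_poly)
qed

text \<open>
  The combination is the coefficient of \<open>t ^ (p ^ s - 1)\<close> in the derivative with
  respect to \<open>t\<close> of the master polynomial, hence \<open>p ^ s\<close> times a coefficient of the latter.
\<close>
lemma Tpol_shift_relation:
  assumes n: "nat ((int p ^ s - lam) div 2) = Suc n" and p: "p > 0"
  shows "of_nat p ^ s dvd of_nat (Suc n) * Tpol p s (lam + 2)
     + of_nat a * (Ivec p s lam $ 1 + Ivec p s lam $ 2)"
proof -
  have n': "nat ((int p ^ s - (lam + 2)) div 2) = n" using n by simp
  have pz: "pderiv (t_minus_z k) = 1" for k by (simp add: t_minus_z_def pderiv_pCons one_pCons)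
  interpret D: derivation "pderiv :: int poly poly poly \<Rightarrow> _" by (rule derivation_pderiv)
  have pt: "pderiv ([:0, 1:] :: int poly poly poly) = 1" by (simp add: pderiv_pCons one_pCons)
  have "pderiv (Phi p s lam) =
      of_nat (Suc n) * Phi p s (lam + 2) + of_nat a * (Phi_div p s lam 1 + Phi_div p s lam 2)"
    unfolding Phi_def Phi_div_def n n' a_def[symmetric] D.mult D.power pz pt
    by (simp add: algebra_simps)
  then have "of_nat (Suc n) * Tpol p s (lam + 2) + of_nat a * (Ivec p s lam $ 1 + Ivec p s lam $ 2)
      = Polynomial.coeff (pderiv (Phi p s lam)) (p ^ s - 1)"
    by (simp only: Tpol_def Ivec_eq_coeff_Phi_div of_nat_mult_conv_smult coeff_add coeff_smult)
  also have "\<dots> = of_nat (p ^ s) * Polynomial.coeff (Phi p s lam) (p ^ s)"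
    using p by (simp add: coeff_pderiv del: of_nat_power)
  finally show ?thesis by simp
qed

end

section \<open>Sequences of ratios\<close>

text \<open>
  The differences of successive quotients \<open>A s / B s\<close>, multiplied by their denominators, tend to 0
  at the rate \<open>p ^ s\<close>, up to a fixed bounded denominator \<open>d\<close>. Being a statement about integer
  polynomials, it can be differentiated, evaluated and expanded at any point.
\<close>
definition ratio_cauchy ::
  "nat \<Rightarrow> nat \<Rightarrow> (nat \<Rightarrow> int poly poly) \<Rightarrow> (nat \<Rightarrow> int poly poly) \<Rightarrow> bool" where
  "ratio_cauchy p s0 A B \<longleftrightarrow> (\<exists>d::int. d \<noteq> 0 \<and>
     (\<forall>s\<ge>s0. of_nat p ^ s dvd of_int d * (A (Suc s) * B s - A s * B (Suc s))))"

text \<open>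
  The quotient rule. After multiplication with \<open>B s\<close> the numerator of the difference is a combination
  of the derivative of the given numerator, of that numerator itself and of the difference of the
  logarithmic derivatives of \<open>B\<close>. The factor \<open>B s\<close> can be cancelled, as \<open>p\<close> is a prime element.
\<close>
lemma ratio_cauchy_pderiv2:
  assumes A: "ratio_cauchy p s0 A B"
    and p: "prime p"
    and B: "\<And>s. s \<ge> s0 \<Longrightarrow> \<not> of_nat p dvd B s"
    and logB: "\<And>s. s \<ge> s0 \<Longrightarrow>
      of_nat p ^ s dvd pderiv2 j (B (Suc s)) * B s - pderiv2 j (B s) * B (Suc s)"
  shows "ratio_cauchy p s0 (\<lambda>s. pderiv2 j (A s)) B"
proof -
  interpret D: derivation "pderiv2 j" by (rule derivation_pderiv2)
  obtain d :: int where d: "d \<noteq> 0"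
    and A: "\<And>s. s \<ge> s0 \<Longrightarrow> of_nat p ^ s dvd of_int d * (A (Suc s) * B s - A s * B (Suc s))"
    using A by (auto simp: ratio_cauchy_def)
  have "of_nat p ^ s dvd of_int d * (pderiv2 j (A (Suc s)) * B s - pderiv2 j (A s) * B (Suc s))"
    if s: "s \<ge> s0" for s
  proof -
    let ?P = "of_nat p ^ s :: int poly poly" and ?d = "of_int d :: int poly poly"
    let ?D = "pderiv2 j" and ?A0 = "A s" and ?A1 = "A (Suc s)" and ?B0 = "B s" and ?B1 = "B (Suc s)"
    have DP: "?D ?P = 0" using D.of_nat[of "p ^ s"] by simp
    obtain R where R: "?d * (?A1 * ?B0 - ?A0 * ?B1) = ?P * R" using A[OF s] by (auto simp: dvd_def)
    have "?D (?d * (?A1 * ?B0 - ?A0 * ?B1)) = ?P * ?D R"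
      unfolding R by (simp add: D.mult DP)
    then have DR: "?d * (?D ?A1 * ?B0 + ?A1 * ?D ?B0 - ?D ?A0 * ?B1 - ?A0 * ?D ?B1) = ?P * ?D R"
      by (simp add: D.mult D.diff D.of_int algebra_simps)
    have "?B0 * (?d * (?D ?A1 * ?B0 - ?D ?A0 * ?B1)) =
      ?B0 * (?d * (?D ?A1 * ?B0 + ?A1 * ?D ?B0 - ?D ?A0 * ?B1 - ?A0 * ?D ?B1))
      - ?D ?B0 * (?d * (?A1 * ?B0 - ?A0 * ?B1)) + ?d * ?A0 * (?D ?B1 * ?B0 - ?D ?B0 * ?B1)"
      by (simp add: algebra_simps)
    also have "?P dvd \<dots>"
      unfolding DR R
      by (intro dvd_add dvd_diff dvd_mult[OF dvd_triv_left] dvd_mult[OF logB[OF s]])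
    finally show ?thesis
      by (rule prime_elem_power_dvd_mult_cancel[OF prime_elem_of_nat_poly_poly[OF p] B[OF s]])
  qed
  then show ?thesis using d by (auto simp: ratio_cauchy_def)
qed

text \<open>
  For \<open>C s = - a A s\<close> with \<open>a = (p ^ s - 1) / 2\<close>, the relation between the derivatives of the \<open>T\<^sub>s\<close> and the
  integrals: \<open>C s\<close> is half of \<open>A s\<close> modulo \<open>p ^ s\<close>.
\<close>
lemma ratio_cauchy_of_half_multiple:
  assumes C: "ratio_cauchy p s0 C B"
    and eq: "\<And>s. s \<ge> s0 \<Longrightarrow> 2 * C s = - ((of_nat p ^ s - 1) * A s)"
  shows "ratio_cauchy p s0 A B"
proof -
  obtain d :: int where d: "d \<noteq> 0"
    and C: "\<And>s. s \<ge> s0 \<Longrightarrow> of_nat p ^ s dvd of_int d * (C (Suc s) * B s - C s * B (Suc s))"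
    using C by (auto simp: ratio_cauchy_def)
  have "of_nat p ^ s dvd of_int d * (A (Suc s) * B s - A s * B (Suc s))" if s: "s \<ge> s0" for s
  proof -
    let ?P = "of_nat p ^ s :: int poly poly" and ?d = "of_int d :: int poly poly"
    have "?d * (A (Suc s) * B s - A s * B (Suc s)) =
      ?d * (- ((of_nat p ^ Suc s - 1) * A (Suc s)) * B s - - ((of_nat p ^ s - 1) * A s) * B (Suc s))
        + ?P * (?d * (of_nat p * A (Suc s) * B s - A s * B (Suc s)))"
      by (simp add: algebra_simps)
    also have "\<dots> = ?d * ((2 * C (Suc s)) * B s - (2 * C s) * B (Suc s))
        + ?P * (?d * (of_nat p * A (Suc s) * B s - A s * B (Suc s)))"
      unfolding eq[OF s] eq[OF le_SucI[OF s]] ..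
    also have "?d * ((2 * C (Suc s)) * B s - (2 * C s) * B (Suc s)) =
      2 * (?d * (C (Suc s) * B s - C s * B (Suc s)))" by (simp add: algebra_simps)
    finally show ?thesis using C[OF s] by (metis dvd_add dvd_mult dvd_triv_left)
  qed
  then show ?thesis using d by (auto simp: ratio_cauchy_def)
qed

lemma ratio_cauchy_integrals:
  fixes p e :: nat and lam :: int and w :: "nat \<Rightarrow> nat"
  assumes p: "prime p" "odd p" and e: "e > 0" and lam: "odd lam" "lam < int p ^ e"
    and w: "\<And>i. w i \<le> p - 1"
    and expansion: "\<And>s. s \<ge> e \<Longrightarrow> nat ((int p ^ s - lam) div 2) = (\<Sum>i<s. w i * p ^ i)"
    and nonzero: "\<And>l n. \<not> of_nat p dvd dwork_coeff p (\<lambda>i. digit_poly p (w (l + i))) n"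
  shows "ratio_cauchy p e (\<lambda>s. Ivec p s lam $ k) (\<lambda>s. Tpol p s lam)"
    and "ratio_cauchy p e (\<lambda>s. Ivec p s (lam + 2) $ k) (\<lambda>s. Tpol p s lam)"
    and "ratio_cauchy p e (\<lambda>s. dIvec j p s lam $ k) (\<lambda>s. Tpol p s lam)"
proof -
  let ?T = "\<lambda>s. Tpol p s lam"
  have p3: "p \<ge> 3" using p prime_ge_2_nat[OF p(1)] by (cases "p = 2") auto
  have T: "?T s = dwork_coeff p (\<lambda>i. digit_poly p (w i)) s" if "s \<ge> e" for s
    by (rule Tpol_eq_dwork_coeff[OF p(2) expansion[OF that]])
  have Tnz: "\<not> of_nat p dvd ?T s" if "s \<ge> e" for s
    using nonzero[of 0 s] T[OF that] by simp
  have logT: "of_nat p ^ s dvd pderiv2 j (?T (Suc s)) * ?T s - pderiv2 j (?T s) * ?T (Suc s)"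
    if s: "s \<ge> e" for s j
    unfolding T[OF s] T[OF le_SucI[OF s]]
    by (rule dwork_log_derivative_congruence[OF frobenius_lift_frob2[OF p] derivation_pderiv2
        pderiv2_frob2[OF p] prime_elem_of_nat_poly_poly[OF p(1)]])
      (use nonzero w degree_digit_poly_le in auto)
  define a where "a s = (p ^ s - 1) div 2" for s
  have a: "2 * a s + 1 = p ^ s" "a s > 0" if s: "s \<ge> e" for s
  proof -
    have "odd (p ^ s)" using p(2) by simp
    then show 1: "2 * a s + 1 = p ^ s" unfolding a_def by (auto elim!: oddE)
    have "p ^ s \<ge> p ^ 1" using s e p3 by (intro power_increasing) auto
    then show "a s > 0" using 1 p3 by simp
  qed
  have a_half: "2 * of_nat (a s) = (of_nat p ^ s - 1 :: int poly poly)" if "s \<ge> e" for s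
  proof -
    have "of_nat (2 * a s + 1) = (of_nat (p ^ s) :: int poly poly)" using a(1)[OF that] by simp
    then show ?thesis by (simp add: eq_diff_eq)
  qed
  have DT: "2 * pderiv2 k (Tpol p s l) = - ((of_nat p ^ s - 1) * Ivec p s l $ k)"
    if "s \<ge> e" for s l k
    using pderiv2_Tpol[OF a_def a(2)[OF that], of k l]
    by (simp only: a_half[OF that, symmetric] mult_minus_right mult.assoc)
  have "ratio_cauchy p e (\<lambda>s. pderiv2 k (?T s)) ?T" for k
    unfolding ratio_cauchy_def using logT by (intro exI[of _ 1]) simp
  then show I: "ratio_cauchy p e (\<lambda>s. Ivec p s lam $ k) ?T" for k
    by (rule ratio_cauchy_of_half_multiple) (rule DT)
  show "ratio_cauchy p e (\<lambda>s. dIvec j p s lam $ k) ?T"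
    unfolding dIvec_def vec_lambda_beta by (rule ratio_cauchy_pderiv2[OF I p(1) Tnz logT])
  have shift: "of_nat p ^ s dvd of_int lam * Tpol p s (lam + 2) + (Ivec p s lam $ 1 + Ivec p s lam $ 2)"
    if s: "s \<ge> e" for s
  proof -
    have "int p ^ e \<le> int p ^ s" using s p3 by (intro power_increasing) auto
    then have lt: "lam < int p ^ s" using lam by simp
    have "odd (int p ^ s)" using p(2) by simp
    then have ev: "even (int p ^ s - lam)" using lam(1) by simp
    define n where "n = nat ((int p ^ s - lam) div 2) - 1"
    have "q div 2 > 0" if "q > 0" "even q" for q :: int using that by presburger
    then have "(int p ^ s - lam) div 2 > 0" using lt ev by simp
    then have n: "nat ((int p ^ s - lam) div 2) = Suc n" by (simp add: n_def)
    then have "int (Suc n) = (int p ^ s - lam) div 2" by linarith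
    then have "2 * int (Suc n) = int p ^ s - lam" using ev by (metis dvd_mult_div_cancel)
    then have "of_int (2 * int (Suc n)) = (of_int (int p ^ s - lam) :: int poly poly)" by (simp only:)
    then have n2: "2 * of_nat (Suc n) = (of_nat p ^ s - of_int lam :: int poly poly)" by simp
    let ?U = "Tpol p s (lam + 2)" and ?I = "Ivec p s lam $ 1 + Ivec p s lam $ 2"
    have d: "of_nat p ^ s dvd of_nat (Suc n) * ?U + of_nat (a s) * ?I"
      using Tpol_shift_relation[OF a_def a(2)[OF s] n] p3 by simp
    have "of_int lam * ?U + ?I = of_nat p ^ s * (?U + ?I)
        - ((of_nat p ^ s - of_int lam) * ?U + (of_nat p ^ s - 1) * ?I)"
      by (simp add: algebra_simps)
    also have "\<dots> = of_nat p ^ s * (?U + ?I) - 2 * (of_nat (Suc n) * ?U + of_nat (a s) * ?I)"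
      unfolding n2[symmetric] a_half[OF s, symmetric] by (simp only: distrib_left mult.assoc)
    finally show ?thesis using d by (metis dvd_diff dvd_mult dvd_triv_left)
  qed
  obtain d1 d2 :: int where d: "d1 \<noteq> 0" "d2 \<noteq> 0"
    and d1: "\<And>s. s \<ge> e \<Longrightarrow> of_nat p ^ s dvd of_int d1 * (Ivec p (Suc s) lam $ 1 * ?T s - Ivec p s lam $ 1 * ?T (Suc s))"
    and d2: "\<And>s. s \<ge> e \<Longrightarrow> of_nat p ^ s dvd of_int d2 * (Ivec p (Suc s) lam $ 2 * ?T s - Ivec p s lam $ 2 * ?T (Suc s))"
    using I[of 1] I[of 2] unfolding ratio_cauchy_def by blast
  have "ratio_cauchy p e (\<lambda>s. Tpol p s (lam + 2)) ?T"
    unfolding ratio_cauchy_def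
  proof (intro exI[of _ "lam * d1 * d2"] conjI allI impI)
    show "lam * d1 * d2 \<noteq> 0" using lam(1) d by auto
  next
    fix s assume s: "s \<ge> e"
    let ?P = "of_nat p ^ s :: int poly poly"
    let ?J = "\<lambda>s. of_int lam * Tpol p s (lam + 2) + (Ivec p s lam $ 1 + Ivec p s lam $ 2)"
    have J: "?P dvd ?J (Suc s)" using shift[of "Suc s"] s by (metis dvd_mult_right power_Suc le_SucI)
    have "?P dvd of_int (d1 * d2) * (?J (Suc s) * ?T s - ?J s * ?T (Suc s))
      - of_int d2 * (of_int d1 * (Ivec p (Suc s) lam $ 1 * ?T s - Ivec p s lam $ 1 * ?T (Suc s)))
      - of_int d1 * (of_int d2 * (Ivec p (Suc s) lam $ 2 * ?T s - Ivec p s lam $ 2 * ?T (Suc s)))"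
      by (rule dvd_diff[OF dvd_diff[OF dvd_mult[OF dvd_diff[OF dvd_mult2[OF J] dvd_mult2[OF shift[OF s]]]]
          dvd_mult[OF d1[OF s]]] dvd_mult[OF d2[OF s]]])
    also have "\<dots> = of_int (lam * d1 * d2) * (Tpol p (Suc s) (lam + 2) * ?T s - Tpol p s (lam + 2) * ?T (Suc s))"
      by (simp add: algebra_simps)
    finally show "?P dvd of_int (lam * d1 * d2) * (Tpol p (Suc s) (lam + 2) * ?T s - Tpol p s (lam + 2) * ?T (Suc s))" .
  qed
  then have "ratio_cauchy p e (\<lambda>s. pderiv2 k (Tpol p s (lam + 2))) ?T"
    by (rule ratio_cauchy_pderiv2[OF _ p(1) Tnz logT])
  then show "ratio_cauchy p e (\<lambda>s. Ivec p s (lam + 2) $ k) ?T"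
    by (rule ratio_cauchy_of_half_multiple) (rule DT)
qed

section \<open>Complete non-archimedean fields\<close>

definition cauchy_abs :: "('a::field \<Rightarrow> real) \<Rightarrow> (nat \<Rightarrow> 'a) \<Rightarrow> bool" where
  "cauchy_abs N u \<longleftrightarrow> (\<forall>\<epsilon>>0. \<exists>M. \<forall>k\<ge>M. \<forall>n\<ge>M. N (u k - u n) < \<epsilon>)"

definition complete_abs :: "'a::field set \<Rightarrow> ('a \<Rightarrow> real) \<Rightarrow> bool" where
  "complete_abs S N \<longleftrightarrow> (\<forall>u. (\<forall>n. u n \<in> S) \<longrightarrow> cauchy_abs N u \<longrightarrow>
     (\<exists>x\<in>S. (\<lambda>n. N (u n - x)) \<longlonglongrightarrow> 0))"

locale nonarch_field =
  fixes K :: "'a::field set" and N :: "'a \<Rightarrow> real"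
  assumes subfield: "subfield_of K" and nonarch: "nonarch_abs_on K N"
begin

lemma zero_in [simp]: "0 \<in> K" and one_in [simp]: "1 \<in> K"
  and add_in: "x \<in> K \<Longrightarrow> y \<in> K \<Longrightarrow> x + y \<in> K"
  and mult_in: "x \<in> K \<Longrightarrow> y \<in> K \<Longrightarrow> x * y \<in> K"
  and uminus_in: "x \<in> K \<Longrightarrow> - x \<in> K"
  and inverse_in: "x \<in> K \<Longrightarrow> inverse x \<in> K"
  using subfield by (auto simp: subfield_of_def)

lemma diff_in: "x \<in> K \<Longrightarrow> y \<in> K \<Longrightarrow> x - y \<in> K"
  using add_in[of x "- y"] uminus_in[of y] by simp

lemma divide_in: "x \<in> K \<Longrightarrow> y \<in> K \<Longrightarrow> x / y \<in> K"
  by (simp add: divide_inverse mult_in inverse_in)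

lemma power_in: "x \<in> K \<Longrightarrow> x ^ n \<in> K"
  by (induction n) (simp_all add: mult_in)

lemma of_nat_in: "of_nat n \<in> K"
  by (induction n) (simp_all add: add_in)

lemma of_int_in: "of_int n \<in> K"
  by (cases n rule: int_cases2) (simp_all add: of_nat_in uminus_in)

lemma N_nonneg: "x \<in> K \<Longrightarrow> N x \<ge> 0"
  and N_eq_0: "x \<in> K \<Longrightarrow> N x = 0 \<longleftrightarrow> x = 0"
  and N_mult: "x \<in> K \<Longrightarrow> y \<in> K \<Longrightarrow> N (x * y) = N x * N y"
  and N_add: "x \<in> K \<Longrightarrow> y \<in> K \<Longrightarrow> N (x + y) \<le> max (N x) (N y)"
  using nonarch by (auto simp: nonarch_abs_on_def)

lemma N_0 [simp]: "N 0 = 0"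
  using N_eq_0[of 0] by simp

lemma N_1 [simp]: "N 1 = 1"
  using N_mult[of 1 1] N_eq_0[of 1] by simp

lemma N_uminus:
  assumes "x \<in> K"
  shows "N (- x) = N x"
proof -
  have "N (- 1) * N (- 1) = 1" using N_mult[of "- 1" "- 1"] uminus_in[OF one_in] by simp
  moreover have "N (- 1) \<ge> 0" using N_nonneg uminus_in[OF one_in] by simp
  ultimately have "N (- 1) = 1" by (metis abs_of_nonneg abs_one power2_eq_square real_sqrt_abs real_sqrt_one)
  then show ?thesis using N_mult[of "- 1" x] uminus_in[OF one_in] assms by simp
qed

lemma N_diff: "x \<in> K \<Longrightarrow> y \<in> K \<Longrightarrow> N (x - y) \<le> max (N x) (N y)"
  using N_add[of x "- y"] N_uminus uminus_in by simp

lemma N_diff_commute: "x \<in> K \<Longrightarrow> y \<in> K \<Longrightarrow> N (x - y) = N (y - x)"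
  using N_uminus[of "x - y"] diff_in by simp

lemma N_add_le: "x \<in> K \<Longrightarrow> y \<in> K \<Longrightarrow> N x \<le> c \<Longrightarrow> N y \<le> c \<Longrightarrow> N (x + y) \<le> c"
  using N_add[of x y] by simp

lemma N_diff_le: "x \<in> K \<Longrightarrow> y \<in> K \<Longrightarrow> N x \<le> c \<Longrightarrow> N y \<le> c \<Longrightarrow> N (x - y) \<le> c"
  using N_diff[of x y] by simp

lemma N_power: "x \<in> K \<Longrightarrow> N (x ^ n) = N x ^ n"
  by (induction n) (simp_all add: N_mult power_in)

lemma N_inverse: "x \<in> K \<Longrightarrow> N (inverse x) = inverse (N x)"
  using N_mult[of x "inverse x"] inverse_in[of x]
  by (cases "x = 0") (auto simp: N_eq_0 inverse_unique)

lemma N_divide: "x \<in> K \<Longrightarrow> y \<in> K \<Longrightarrow> N (x / y) = N x / N y"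
  by (simp add: divide_inverse N_mult N_inverse inverse_in)

lemma N_of_nat_le: "N (of_nat n) \<le> 1"
  by (induction n) (auto intro!: N_add_le simp: of_nat_in)

lemma N_of_int_le: "N (of_int n) \<le> 1"
  by (cases n rule: int_cases2) (simp_all add: N_of_nat_le N_uminus of_nat_in)

lemma sum_in: "(\<And>i. i \<in> A \<Longrightarrow> f i \<in> K) \<Longrightarrow> sum f A \<in> K"
  by (induction A rule: infinite_finite_induct) (simp_all add: add_in)

lemma N_sum_le:
  "(\<And>i. i \<in> A \<Longrightarrow> f i \<in> K) \<Longrightarrow> (\<And>i. i \<in> A \<Longrightarrow> N (f i) \<le> c) \<Longrightarrow> c \<ge> 0 \<Longrightarrow> N (sum f A) \<le> c"
  by (induction A rule: infinite_finite_induct) (auto intro!: N_add_le sum_in)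

lemma limit_unique:
  assumes "x \<in> K" "y \<in> K" and "\<And>n. u n \<in> K"
    and "(\<lambda>n. N (u n - x)) \<longlonglongrightarrow> 0" and "(\<lambda>n. N (u n - y)) \<longlonglongrightarrow> 0"
  shows "x = y"
proof -
  have "(\<lambda>n. N (u n - x) + N (u n - y)) \<longlonglongrightarrow> 0"
    using tendsto_add[OF assms(4,5)] by simp
  moreover have "N (x - y) \<le> N (u n - x) + N (u n - y)" for n
  proof -
    have "x - y = (u n - y) - (u n - x)" by simp
    then have "N (x - y) \<le> max (N (u n - y)) (N (u n - x))"
      using N_diff[of "u n - y" "u n - x"] assms(1-3) by (simp add: diff_in)
    then show ?thesis
      using N_nonneg[of "u n - x"] N_nonneg[of "u n - y"] assms(1-3) by (simp add: diff_in)
  qed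
  ultimately have "N (x - y) \<le> 0" by (intro LIMSEQ_le_const) auto
  then show ?thesis using N_nonneg[of "x - y"] N_eq_0[of "x - y"] assms by (simp add: diff_in)
qed

text \<open>
  By the ultrametric inequality the bound on a single step is already a bound on the whole tail.
\<close>
lemma geometric_limit:
  assumes complete: "complete_abs K N" and u: "\<And>n. u n \<in> K" and C: "C \<ge> 0"
    and step: "\<And>s. s \<ge> s0 \<Longrightarrow> N (u (Suc s) - u s) \<le> C / 2 ^ s"
  shows "\<exists>x\<in>K. \<forall>s\<ge>s0. N (x - u s) \<le> C / 2 ^ s"
proof -
  have tail: "N (u (s + n) - u s) \<le> C / 2 ^ s" if s: "s \<ge> s0" for s n
  proof (induction n)
    case (Suc n)
    have "u (s + Suc n) - u s = (u (Suc (s + n)) - u (s + n)) + (u (s + n) - u s)" by simp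
    moreover have "N (u (Suc (s + n)) - u (s + n)) \<le> C / 2 ^ s"
      using step[of "s + n"] s C
      by (auto elim!: order_trans intro!: divide_left_mono power_increasing mult_pos_pos)
    ultimately show ?case using Suc u by (metis N_add_le diff_in)
  qed (use C in simp)
  have tail': "N (u n - u s) \<le> C / 2 ^ s" if "s \<ge> s0" "n \<ge> s" for s n
    using tail[OF that(1), of "n - s"] that(2) by simp
  have lim: "(\<lambda>s. C / 2 ^ s) \<longlonglongrightarrow> 0"
    using LIMSEQ_divide_realpow_zero[of 2 C] by simp
  have "cauchy_abs N u"
    unfolding cauchy_abs_def
  proof (intro allI impI)
    fix \<epsilon> :: real assume "\<epsilon> > 0"
    with lim have "\<forall>\<^sub>F s in sequentially. C / 2 ^ s < \<epsilon>" by (rule order_tendstoD)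
    then obtain M where M: "C / 2 ^ s < \<epsilon>" if "s \<ge> M" for s
      unfolding eventually_sequentially by blast
    let ?M = "max M s0"
    have "N (u k - u n) < \<epsilon>" if "k \<ge> ?M" "n \<ge> ?M" for k n
    proof -
      have "u k - u n = (u k - u ?M) - (u n - u ?M)" by simp
      then have "N (u k - u n) \<le> C / 2 ^ ?M"
        using tail'[of ?M k] tail'[of ?M n] that u by (metis N_diff_le diff_in max.cobounded2)
      also have "\<dots> < \<epsilon>" by (rule M) simp
      finally show ?thesis .
    qed
    then show "\<exists>M. \<forall>k\<ge>M. \<forall>n\<ge>M. N (u k - u n) < \<epsilon>" by blast
  qed
  then obtain x where x: "x \<in> K" and ux: "(\<lambda>n. N (u n - x)) \<longlonglongrightarrow> 0"
    using complete u unfolding complete_abs_def by blast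
  have "N (x - u s) \<le> C / 2 ^ s" if s: "s \<ge> s0" for s
  proof -
    have "N (x - u s) \<le> N (u n - x) + C / 2 ^ s" if n: "n \<ge> s" for n
    proof -
      have "x - u s = (u n - u s) - (u n - x)" by simp
      then have "N (x - u s) \<le> max (N (u n - u s)) (N (u n - x))"
        using N_diff[of "u n - u s" "u n - x"] u x by (simp add: diff_in)
      moreover have "N (u n - x) \<ge> 0" using u x by (simp add: N_nonneg diff_in)
      moreover have "C / 2 ^ s \<ge> 0" using C by simp
      ultimately show ?thesis using tail'[OF s n] by linarith
    qed
    moreover have "(\<lambda>n. N (u n - x) + C / 2 ^ s) \<longlonglongrightarrow> 0 + C / 2 ^ s"
      by (intro tendsto_add ux tendsto_const)
    ultimately have "N (x - u s) \<le> 0 + C / 2 ^ s" by (intro LIMSEQ_le_const) auto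
    then show ?thesis by simp
  qed
  then show ?thesis using x by blast
qed

end

text \<open>
  A line is added to a complete subspace \<open>S\<close>. A vector \<open>x\<close> outside of \<open>S\<close> has positive distance \<open>\<delta>\<close> from
  \<open>S\<close>, for otherwise \<open>x\<close> would be the limit of a sequence in \<open>S\<close>. So \<open>v c * \<delta> \<le> N (c x + w)\<close> for \<open>w\<close> in
  \<open>S\<close>, and both components of a Cauchy sequence in the larger space are Cauchy sequences.
\<close>
lemma complete_abs_span:
  fixes v :: "'q::field \<Rightarrow> real" and K :: "'q alg_closure set" and N
  assumes "nonarch_field K N" and Kto: "range to_ac \<subseteq> K" and Nv: "\<And>x. N (to_ac x) = v x"
    and v: "complete_abs UNIV v" and "finite B" and "B \<subseteq> K"
  shows "complete_abs (module.span (\<lambda>(c::'q) x. to_ac c * x) B) N"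
  using \<open>finite B\<close> \<open>B \<subseteq> K\<close>
proof (induction B)
  interpret nonarch_field K N by fact
  interpret vs: vector_space "\<lambda>(c::'q) x. to_ac c * x"
    by unfold_locales (simp_all add: algebra_simps)
  have to_in: "to_ac c \<in> K" for c using Kto by auto
  have sub: "vs.subspace K" by (simp add: vs.subspace_def add_in mult_in to_in)
  have span_sub: "vs.span B \<subseteq> K" if "B \<subseteq> K" for B
    using vs.span_minimal[OF that sub] .
  {
    case empty
    show ?case by (auto simp: complete_abs_def intro!: tendsto_eventually)
  next
    case (insert x B)
    let ?S = "vs.span B"
    have S: "complete_abs ?S N" and SK: "?S \<subseteq> K" and x: "x \<in> K"
      using insert span_sub by auto
    show ?case
    proof (cases "x \<in> ?S")
      case True
      then show ?thesis using S by (simp add: vs.span_redundant)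
    next
      case False
      have "\<exists>\<delta>>0. \<forall>w\<in>?S. \<delta> \<le> N (x - w)"
      proof (rule ccontr)
        assume "\<not> ?thesis"
        then have "\<exists>w\<in>?S. N (x - w) < 1 / real (Suc n)" for n
          by (metis not_le of_nat_0_less_iff zero_less_Suc zero_less_divide_1_iff)
        then obtain w where wS: "\<And>n. w n \<in> ?S" and w: "\<And>n. N (x - w n) < 1 / real (Suc n)" by metis
        have wK: "w n \<in> K" for n using wS SK by blast
        have wx: "N (w n - x) < 1 / real (Suc n)" for n
          using w[of n] N_diff_commute[OF x wK] by simp
        have "cauchy_abs N w"
          unfolding cauchy_abs_def
        proof (intro allI impI)
          fix \<epsilon> :: real assume "\<epsilon> > 0"
          then obtain M where M: "1 / real (Suc M) < \<epsilon>" using nat_approx_posE by (metis of_nat_Suc)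
          have small: "N (w n - x) < \<epsilon>" if "n \<ge> M" for n
          proof -
            have "1 / real (Suc n) \<le> 1 / real (Suc M)" using that by (simp add: frac_le)
            then show ?thesis using wx[of n] M by linarith
          qed
          have "N (w k - w n) < \<epsilon>" if "k \<ge> M" "n \<ge> M" for k n
            using N_diff[of "w k - x" "w n - x"] small[OF that(1)] small[OF that(2)] wK x
            by (simp add: diff_in)
          then show "\<exists>M. \<forall>k\<ge>M. \<forall>n\<ge>M. N (w k - w n) < \<epsilon>" by blast
        qed
        then obtain y where y: "y \<in> ?S" "(\<lambda>n. N (w n - y)) \<longlonglongrightarrow> 0"
          using S wS unfolding complete_abs_def by blast
        have "(\<lambda>n. N (w n - x)) \<longlonglongrightarrow> 0"
        proof (rule tendsto_sandwich[OF _ _ tendsto_const LIMSEQ_inverse_real_of_nat])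
          show "\<forall>\<^sub>F n in sequentially. 0 \<le> N (w n - x)"
            using N_nonneg wK x by (simp add: diff_in)
          show "\<forall>\<^sub>F n in sequentially. N (w n - x) \<le> inverse (real (Suc n))"
            using wx by (simp add: less_imp_le inverse_eq_divide)
        qed
        then have "x = y" using limit_unique[OF x subsetD[OF SK y(1)] wK _ y(2)] by simp
        then show False using False y(1) by simp
      qed
      then obtain \<delta> where \<delta>: "\<delta> > 0" "\<And>w. w \<in> ?S \<Longrightarrow> \<delta> \<le> N (x - w)" by blast
      have lower: "v c * \<delta> \<le> N (to_ac c * x + w)" if w: "w \<in> ?S" for c w
      proof (cases "c = 0")
        case True
        then have "v c = 0" using Nv[of 0] by simp
        then show ?thesis using N_nonneg[of "to_ac c * x + w"] w SK x
          by (auto simp: add_in mult_in to_in)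
      next
        case False
        have "to_ac (- inverse c) * w \<in> ?S" using w by (rule vs.span_scale)
        then have "\<delta> \<le> N (x - to_ac (- inverse c) * w)" by (rule \<delta>(2))
        moreover have "N (to_ac c * x + w) = v c * N (x - to_ac (- inverse c) * w)"
        proof -
          have "to_ac c * (to_ac (- inverse c) * w) = to_ac (c * - inverse c) * w"
            by (simp only: to_ac_mult mult.assoc)
          also have "c * - inverse c = - 1" using False by simp
          finally have "to_ac c * (x - to_ac (- inverse c) * w) = to_ac c * x + w"
            by (simp only: right_diff_distrib) simp
          moreover have "x - to_ac (- inverse c) * w \<in> K"
            by (rule diff_in[OF x mult_in[OF to_in subsetD[OF SK w]]])
          ultimately show ?thesis using N_mult[OF to_in] Nv by metis
        qed
        moreover have "v c \<ge> 0" using N_nonneg[OF to_in, of c] Nv by simp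
        ultimately show ?thesis by (simp add: mult_left_mono)
      qed
      show ?thesis
        unfolding complete_abs_def
      proof (intro allI impI)
        fix u :: "nat \<Rightarrow> 'q alg_closure"
        assume "\<forall>n. u n \<in> vs.span (insert x B)" and cu: "cauchy_abs N u"
        then have "\<forall>n. \<exists>c. u n - to_ac c * x \<in> ?S" by (simp add: vs.span_breakdown_eq)
        then obtain c where c: "\<And>n. u n - to_ac (c n) * x \<in> ?S" by metis
        define w where "w n = u n - to_ac (c n) * x" for n
        have wS: "w n \<in> ?S" for n using c by (simp add: w_def)
        then have wK: "w n \<in> K" for n using SK by blast
        have u_eq: "u n = to_ac (c n) * x + w n" for n by (simp add: w_def)
        have uK: "u n \<in> K" for n unfolding u_eq by (intro add_in mult_in to_in x wK)
        have cb: "v (c k - c n) * \<delta> \<le> N (u k - u n)" for k n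
        proof -
          have "u k - u n = to_ac (c k - c n) * x + (w k - w n)"
            by (simp add: u_eq algebra_simps)
          then show ?thesis using lower[OF vs.span_diff[OF wS wS]] by (simp only:)
        qed
        have cc: "cauchy_abs v c"
          unfolding cauchy_abs_def
        proof (intro allI impI)
          fix \<epsilon> :: real assume "\<epsilon> > 0"
          then have "\<epsilon> * \<delta> > 0" using \<delta> by simp
          then obtain M where "\<forall>k\<ge>M. \<forall>n\<ge>M. N (u k - u n) < \<epsilon> * \<delta>"
            using cu unfolding cauchy_abs_def by blast
          then have "\<forall>k\<ge>M. \<forall>n\<ge>M. v (c k - c n) < \<epsilon>"
            using cb \<delta>(1) by (meson le_less_trans mult_less_cancel_right_pos)
          then show "\<exists>M. \<forall>k\<ge>M. \<forall>n\<ge>M. v (c k - c n) < \<epsilon>" by blast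
        qed
        then obtain c' where c': "(\<lambda>n. v (c n - c')) \<longlonglongrightarrow> 0"
          using v unfolding complete_abs_def by blast
        have Ncx: "N (to_ac d * x) = v d * N x" for d
          using N_mult[OF to_in x] Nv by simp
        have cw: "cauchy_abs N w"
          unfolding cauchy_abs_def
        proof (intro allI impI)
          fix \<epsilon> :: real assume \<epsilon>: "\<epsilon> > 0"
          have Nx: "N x \<ge> 0" using N_nonneg[OF x] .
          have "\<epsilon> / (N x + 1) > 0" using \<epsilon> Nx by simp
          then obtain M1 where M1: "\<forall>k\<ge>M1. \<forall>n\<ge>M1. v (c k - c n) < \<epsilon> / (N x + 1)"
            using cc unfolding cauchy_abs_def by blast
          obtain M2 where M2: "\<forall>k\<ge>M2. \<forall>n\<ge>M2. N (u k - u n) < \<epsilon>"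
            using cu \<epsilon> unfolding cauchy_abs_def by blast
          have "N (w k - w n) < \<epsilon>" if "k \<ge> max M1 M2" "n \<ge> max M1 M2" for k n
          proof -
            have vnn: "v (c k - c n) \<ge> 0" using N_nonneg[OF to_in] Nv by metis
            have "v (c k - c n) < \<epsilon> / (N x + 1)" using M1 that by simp
            then have "v (c k - c n) * (N x + 1) < \<epsilon>" using Nx by (simp add: field_simps)
            then have 1: "v (c k - c n) * N x < \<epsilon>" using vnn by (simp add: distrib_left)
            have "w k - w n = (u k - u n) - to_ac (c k - c n) * x"
              by (simp add: w_def algebra_simps)
            then have "N (w k - w n) \<le> max (N (u k - u n)) (N (to_ac (c k - c n) * x))"
              using N_diff[of "u k - u n" "to_ac (c k - c n) * x"] uK x to_in
              by (simp add: diff_in mult_in del: to_ac_diff)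
            also have "\<dots> < \<epsilon>" using 1 M2 that by (simp add: Ncx del: to_ac_diff)
            finally show ?thesis .
          qed
          then show "\<exists>M. \<forall>k\<ge>M. \<forall>n\<ge>M. N (w k - w n) < \<epsilon>" by blast
        qed
        then obtain w' where w': "w' \<in> ?S" "(\<lambda>n. N (w n - w')) \<longlonglongrightarrow> 0"
          using S wS unfolding complete_abs_def by blast
        have "w' \<in> K" using w' SK by blast
        let ?y = "to_ac c' * x + w'"
        have "?y \<in> vs.span (insert x B)"
          unfolding vs.span_breakdown_eq by (rule exI[of _ c']) (simp add: w'(1))
        moreover have "(\<lambda>n. N (u n - ?y)) \<longlonglongrightarrow> 0"
        proof (rule tendsto_sandwich[OF _ _ tendsto_const])
          show "\<forall>\<^sub>F n in sequentially. 0 \<le> N (u n - ?y)"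
            using N_nonneg uK x \<open>w' \<in> K\<close> to_in by (simp add: diff_in add_in mult_in)
          have "N (u n - ?y) \<le> v (c n - c') * N x + N (w n - w')" for n
          proof -
            have eq: "u n - ?y = to_ac (c n - c') * x + (w n - w')" by (simp add: u_eq algebra_simps)
            have "N (u n - ?y) \<le> max (v (c n - c') * N x) (N (w n - w'))"
              unfolding eq using N_add[of "to_ac (c n - c') * x" "w n - w'"] wK \<open>w' \<in> K\<close> x to_in
              by (simp add: Ncx diff_in mult_in del: to_ac_diff)
            moreover have "v (c n - c') * N x \<ge> 0"
              using N_nonneg[OF to_in] Nv N_nonneg[OF x] by (metis mult_nonneg_nonneg)
            moreover have "N (w n - w') \<ge> 0"
              using N_nonneg wK \<open>w' \<in> K\<close> by (simp add: diff_in)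
            ultimately show ?thesis by simp
          qed
          then show "\<forall>\<^sub>F n in sequentially. N (u n - ?y) \<le> v (c n - c') * N x + N (w n - w')" by simp
          show "(\<lambda>n. v (c n - c') * N x + N (w n - w')) \<longlonglongrightarrow> 0"
            using tendsto_add[OF tendsto_mult_right[OF c', of "N x"] w'(2)] by simp
        qed
        ultimately show "\<exists>y\<in>vs.span (insert x B). (\<lambda>n. N (u n - y)) \<longlonglongrightarrow> 0" by blast
      qed
    qed
  }
qed

lemma complete_abs_unramified_extension:
  fixes v :: "'q::field_char_0 \<Rightarrow> real"
  assumes v: "padic_numbers p v" and K: "unramified_extension v m K N" and m: "m > 0"
  shows "complete_abs K N"
proof -
  interpret vs: vector_space "\<lambda>(c::'q) x. to_ac c * x"
    by unfold_locales (simp_all add: algebra_simps)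
  interpret nonarch_field K N
    using K by unfold_locales (simp_all add: unramified_extension_def)
  have Kto: "range to_ac \<subseteq> K" and dim: "vs.dim K = m" and Nv: "\<And>x. N (to_ac x) = v x"
    using K by (simp_all add: unramified_extension_def)
  have "to_ac c \<in> K" for c using Kto by auto
  then have sub: "vs.subspace K" by (simp add: vs.subspace_def add_in mult_in)
  obtain B where B: "B \<subseteq> K" "vs.independent B" "K \<subseteq> vs.span B" "card B = vs.dim K"
    by (rule vs.basis_exists)
  have "finite B" using B(4) dim m by (simp add: card_ge_0_finite)
  have "complete_abs UNIV v"
    using v by (simp add: padic_numbers_def complete_abs_def cauchy_abs_def)
  from complete_abs_span[OF nonarch_field_axioms Kto Nv this \<open>finite B\<close> B(1)]
  have "complete_abs (vs.span B) N" .
  moreover have "vs.span B = K" using B(3) vs.span_minimal[OF B(1) sub] by blast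
  ultimately show ?thesis by simp
qed

section \<open>Gauss norms\<close>

abbreviation coeff2 :: "'a::zero poly poly \<Rightarrow> nat \<Rightarrow> nat \<Rightarrow> 'a" where
  "coeff2 P i j \<equiv> Polynomial.coeff (Polynomial.coeff P j) i"

definition poly2 :: "'a::comm_ring_1 poly poly \<Rightarrow> 'a ^ 2 \<Rightarrow> 'a" where
  "poly2 P y = poly (poly P [:y $ 2:]) (y $ 1)"

lemma poly2_morphism: "comm_ring_morphism (\<lambda>P. poly2 P y)"
  by unfold_locales (simp_all add: poly2_def)

lemma poly2_const: "poly2 [:[:c:]:] y = c"
  by (simp add: poly2_def)

lemma const2_mult: "[:[:a:]:] * ([:[:b:]:] * P) = [:[:a * b:]:] * (P :: 'a::comm_ring_1 poly poly)"
  by (simp add: mult.assoc[symmetric])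

text \<open>
  In the form needed for unconditional sums: every finite set of exponents that contains the
  support will do.
\<close>
lemma poly2_eq_sum:
  "\<exists>F0. finite F0 \<and> (\<forall>F. finite F \<and> F0 \<subseteq> F \<longrightarrow>
     poly2 P y = (\<Sum>(i, j)\<in>F. coeff2 P i j * (y $ 1) ^ i * (y $ 2) ^ j))"
proof -
  let ?g = "\<lambda>(i, j). coeff2 P i j * (y $ 1) ^ i * (y $ 2) ^ j"
  define n where "n = (\<Sum>j\<le>Polynomial.degree P. Polynomial.degree (Polynomial.coeff P j))"
  let ?F0 = "{..n} \<times> {..Polynomial.degree P}"
  have deg: "Polynomial.degree (Polynomial.coeff P j) \<le> n" if "j \<le> Polynomial.degree P" for j
    unfolding n_def by (rule member_le_sum[where f = "\<lambda>j. Polynomial.degree (Polynomial.coeff P j)"]) (use that in auto)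
  have inner: "poly (Polynomial.coeff P j) (y $ 1) = (\<Sum>i\<le>n. coeff2 P i j * (y $ 1) ^ i)"
    if "j \<le> Polynomial.degree P" for j
    unfolding poly_altdef
    by (rule sum.mono_neutral_left) (use deg[OF that] in \<open>auto simp: coeff_eq_0\<close>)
  have "poly2 P y = (\<Sum>j\<le>Polynomial.degree P. poly (Polynomial.coeff P j) (y $ 1) * (y $ 2) ^ j)"
    unfolding poly2_def poly_altdef[of P] by (simp add: poly_sum poly_const_pow mult.commute)
  also have "\<dots> = (\<Sum>j\<le>Polynomial.degree P. \<Sum>i\<le>n. coeff2 P i j * (y $ 1) ^ i * (y $ 2) ^ j)"
    by (intro sum.cong) (simp_all add: inner sum_distrib_right)
  also have "\<dots> = sum ?g ?F0"
    by (subst sum.swap) (simp add: sum.cartesian_product)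
  finally have box: "poly2 P y = sum ?g ?F0" .
  have zero: "coeff2 P i j = 0" if "(i, j) \<notin> ?F0" for i j
  proof (cases "j \<le> Polynomial.degree P")
    case True
    then show ?thesis using that deg[OF True] by (auto simp: coeff_eq_0)
  qed (simp add: coeff_eq_0)
  have "poly2 P y = sum ?g F" if "finite F" "?F0 \<subseteq> F" for F
    unfolding box
  proof (rule sum.mono_neutral_left[OF that])
    show "\<forall>ij\<in>F - ?F0. ?g ij = 0"
    proof
      fix ij assume "ij \<in> F - ?F0"
      then show "?g ij = 0" using zero[of "fst ij" "snd ij"] by (simp add: split_beta)
    qed
  qed
  then show ?thesis by (intro exI[of _ ?F0]) auto
qed

context nonarch_field
begin

text \<open>
  The Gauss norm of \<open>P\<close> for the polydisc of radius \<open>1 / \<rho>\<close> is at most \<open>c\<close>. For \<open>\<rho> = 1\<close> and \<open>c = 1\<close> this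
  means that the coefficients are integral. With \<open>\<rho> = 2\<close> integral polynomials without constant term
  become topologically nilpotent.
\<close>
definition gauss_le :: "real \<Rightarrow> 'a poly poly \<Rightarrow> real \<Rightarrow> bool" where
  "gauss_le \<rho> P c \<longleftrightarrow> (\<forall>i j. coeff2 P i j \<in> K \<and> N (coeff2 P i j) \<le> c * \<rho> ^ (i + j))"

lemma gauss_leI:
  "(\<And>i j. coeff2 P i j \<in> K) \<Longrightarrow> (\<And>i j. N (coeff2 P i j) \<le> c * \<rho> ^ (i + j)) \<Longrightarrow> gauss_le \<rho> P c"
  by (simp add: gauss_le_def)

lemma gauss_le_in: "gauss_le \<rho> P c \<Longrightarrow> coeff2 P i j \<in> K"
  and gauss_leD: "gauss_le \<rho> P c \<Longrightarrow> N (coeff2 P i j) \<le> c * \<rho> ^ (i + j)"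
  by (simp_all add: gauss_le_def)

lemma gauss_le_mono:
  assumes "gauss_le \<rho> P c" "c \<le> c'" "\<rho> \<le> \<rho>'" "0 \<le> c" "0 \<le> \<rho>"
  shows "gauss_le \<rho>' P c'"
proof (rule gauss_leI)
  fix i j
  have "c * \<rho> ^ (i + j) \<le> c' * \<rho>' ^ (i + j)"
    using assms by (intro mult_mono power_mono) auto
  then show "N (coeff2 P i j) \<le> c' * \<rho>' ^ (i + j)"
    using gauss_leD[OF assms(1), where i = i and j = j] by linarith
qed (rule gauss_le_in[OF assms(1)])

lemma gauss_le_add: "gauss_le \<rho> P c \<Longrightarrow> gauss_le \<rho> Q c \<Longrightarrow> gauss_le \<rho> (P + Q) c"
  by (simp add: gauss_le_def add_in N_add_le)

lemma gauss_le_diff: "gauss_le \<rho> P c \<Longrightarrow> gauss_le \<rho> Q c \<Longrightarrow> gauss_le \<rho> (P - Q) c"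
  by (simp add: gauss_le_def diff_in N_diff_le)

lemma gauss_le_const:
  assumes "x \<in> K" "N x \<le> c" "0 \<le> c" "0 \<le> \<rho>"
  shows "gauss_le \<rho> [:[:x:]:] c"
  using assms by (auto simp: gauss_le_def coeff_pCons split: nat.splits)

lemma gauss_le_mult:
  assumes "gauss_le \<rho> P c" "gauss_le \<rho> Q d" "0 \<le> c" "0 \<le> d" "0 \<le> \<rho>"
  shows "gauss_le \<rho> (P * Q) (c * d)"
proof -
  have coeff: "coeff2 (P * Q) i j =
      (\<Sum>b\<le>j. \<Sum>a\<le>i. coeff2 P a b * coeff2 Q (i - a) (j - b))" for i j
    by (simp add: coeff_mult Polynomial.coeff_sum)
  have in_K: "coeff2 P a b * coeff2 Q i j \<in> K" for a b i j
    using assms by (intro mult_in gauss_le_in)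
  have "N (coeff2 P a b * coeff2 Q (i - a) (j - b)) \<le> c * d * \<rho> ^ (i + j)"
    if "a \<le> i" "b \<le> j" for a b i j
  proof -
    have "N (coeff2 P a b * coeff2 Q (i - a) (j - b)) =
        N (coeff2 P a b) * N (coeff2 Q (i - a) (j - b))"
      using assms by (intro N_mult gauss_le_in)
    also have "\<dots> \<le> (c * \<rho> ^ (a + b)) * (d * \<rho> ^ ((i - a) + (j - b)))"
      using assms by (intro mult_mono gauss_leD N_nonneg gauss_le_in) auto
    also have "\<dots> = c * d * \<rho> ^ ((a + b) + ((i - a) + (j - b)))"
      by (simp add: power_add)
    also have "(a + b) + ((i - a) + (j - b)) = i + j" using that by simp
    finally show ?thesis .
  qed
  then show ?thesis
    unfolding gauss_le_def coeff using assms(3-5)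
    by (auto intro!: sum_in N_sum_le in_K)
qed

lemma gauss_le_1_1:
  assumes "1 \<le> \<rho>"
  shows "gauss_le \<rho> 1 1"
  using gauss_le_const[of 1 1 \<rho>] assms by (simp add: one_pCons)

lemma gauss_le_power:
  assumes "gauss_le \<rho> P c" "0 \<le> c" "1 \<le> \<rho>"
  shows "gauss_le \<rho> (P ^ n) (c ^ n)"
proof (induction n)
  case (Suc n)
  then show ?case using gauss_le_mult[OF assms(1) Suc] assms by simp
qed (simp add: gauss_le_1_1 assms)

lemma gauss_le_sum:
  assumes "\<And>i. i \<in> A \<Longrightarrow> gauss_le \<rho> (f i) c" "0 \<le> c" "0 \<le> \<rho>"
  shows "gauss_le \<rho> (sum f A) c"
  using assms(1)
proof (induction A rule: infinite_finite_induct)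
  case (insert x A)
  then show ?case by (simp add: gauss_le_add)
qed (use assms in \<open>simp_all add: gauss_le_def\<close>)

lemma gauss_le_half:
  assumes "gauss_le 1 P 1" and "coeff2 P 0 0 = 0"
  shows "gauss_le 2 P (1 / 2)"
proof (rule gauss_leI)
  fix i j
  show "N (coeff2 P i j) \<le> 1 / 2 * 2 ^ (i + j)"
  proof (cases "i + j = 0")
    case False
    then obtain k where "i + j = Suc k" by (cases "i + j") auto
    then have "(1::real) \<le> 1 / 2 * 2 ^ (i + j)" by simp
    then show ?thesis using gauss_leD[OF assms(1), where i = i and j = j] by simp
  qed (use assms(2) in simp)
qed (rule gauss_le_in[OF assms(1)])

lemma N_poly2_le:
  assumes P: "gauss_le 2 P c" and c: "0 \<le> c"
    and y: "\<And>k. y $ k \<in> K" "\<And>k. N (y $ k) \<le> 1 / 2"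
  shows "N (poly2 P y) \<le> c" and "poly2 P y \<in> K"
    and "N (coeff2 P i j * (y $ 1) ^ i * (y $ 2) ^ j) \<le> c"
    and "coeff2 P i j * (y $ 1) ^ i * (y $ 2) ^ j \<in> K"
proof -
  show in_K: "coeff2 P i j * (y $ 1) ^ i * (y $ 2) ^ j \<in> K" for i j
    using y gauss_le_in[OF P] by (intro mult_in power_in)
  show bound: "N (coeff2 P i j * (y $ 1) ^ i * (y $ 2) ^ j) \<le> c" for i j
  proof -
    have "N (coeff2 P i j * (y $ 1) ^ i * (y $ 2) ^ j) =
        N (coeff2 P i j) * N (y $ 1) ^ i * N (y $ 2) ^ j"
      using y gauss_le_in[OF P] by (simp add: N_mult N_power mult_in power_in)
    also have "\<dots> \<le> (c * 2 ^ (i + j)) * (1 / 2) ^ i * (1 / 2) ^ j"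
      using y N_nonneg gauss_leD[OF P] gauss_le_in[OF P] c
      by (intro mult_mono power_mono) auto
    also have "\<dots> = c" by (simp add: power_add power_divide)
    finally show ?thesis .
  qed
  obtain F where "finite F" and F: "poly2 P y = (\<Sum>(i, j)\<in>F. coeff2 P i j * (y $ 1) ^ i * (y $ 2) ^ j)"
    using poly2_eq_sum[of P y] by blast
  show "N (poly2 P y) \<le> c" and "poly2 P y \<in> K"
    unfolding F using in_K bound c by (auto intro!: N_sum_le sum_in)
qed

section \<open>Taylor expansions of integer polynomials\<close>

definition taylor2 :: "'a ^ 2 \<Rightarrow> int poly poly \<Rightarrow> 'a poly poly" where
  "taylor2 a f = eval2 f (\<chi> k. if k = 1 then [:[:a $ 1, 1:]:] else [:[:a $ 2:], 1:])"

lemma taylor2_morphism: "comm_ring_morphism (taylor2 a)"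
  using eval2_morphism by (simp add: taylor2_def[abs_def])

lemma poly2_taylor2: "poly2 (taylor2 a f) y = eval2 f (a + y)"
proof -
  have "(\<chi> k. poly2 ((\<chi> k. if k = 1 then [:[:a $ 1, 1:]:] else [:[:a $ 2:], 1:]) $ k) y) = a + y"
    using exhaust_2 by (auto simp: vec_eq_iff poly2_def)
  then show ?thesis
    unfolding taylor2_def using morphism_eval2[OF poly2_morphism] by metis
qed

lemma coeff2_0_0: "coeff2 P 0 0 = poly2 P 0"
  by (simp add: poly2_def poly_0_coeff_0)

lemma gauss_le_taylor2:
  assumes "\<And>k. a $ k \<in> K" "\<And>k. N (a $ k) \<le> 1"
  shows "gauss_le 1 (taylor2 a f) 1"
proof -
  interpret T: comm_ring_morphism "taylor2 a" by (rule taylor2_morphism)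
  show ?thesis
  proof (induction f rule: int_poly_poly_induct)
    case (of_int c)
    show ?case
      using gauss_le_const[OF of_int_in[of c] N_of_int_le[of c], of 1] unfolding T.of_int by (simp add: of_int_poly)
  next
    case (zvar j)
    show ?case using assms exhaust_2[of j]
      by (auto simp: taylor2_def eval2_zvar gauss_le_def coeff_pCons split: nat.splits)
  next
    case (add f g)
    then show ?case by (simp add: T.add gauss_le_add)
  next
    case (mult f g)
    then show ?case using gauss_le_mult[of 1 _ 1 _ 1] by (simp add: T.mult)
  qed
qed

lemma eval2_in:
  assumes "\<And>k. a $ k \<in> K" "\<And>k. N (a $ k) \<le> 1"
  shows "eval2 f a \<in> K" and "N (eval2 f a) \<le> 1"
  using gauss_le_in[OF gauss_le_taylor2[OF assms, of f], where i = 0 and j = 0]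
    gauss_leD[OF gauss_le_taylor2[OF assms, of f], where i = 0 and j = 0]
  by (simp_all add: coeff2_0_0 poly2_taylor2)

text \<open>
  The Taylor expansion of \<open>f\<close> at \<open>a\<close> without its constant term has Gauss norm at most \<open>1/2\<close> on the
  polydisc of radius \<open>1/2\<close>. This is what makes the domain open.
\<close>
lemma N_eval2_diff_less:
  assumes a: "\<And>k. a $ k \<in> K" "\<And>k. N (a $ k) \<le> 1"
    and x: "\<And>k. x $ k \<in> K" "\<And>k. N (x $ k - a $ k) \<le> 1 / 2"
  shows "N (eval2 f x - eval2 f a) < 1"
proof -
  interpret P: comm_ring_morphism "\<lambda>P. poly2 P y" for y :: "'a ^ 2" by (rule poly2_morphism)
  let ?Q = "taylor2 a f - [:[:eval2 f a:]:]"
  have "gauss_le 2 ?Q (1 / 2)"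
  proof (rule gauss_le_half)
    show "gauss_le 1 ?Q 1"
      using gauss_le_taylor2[OF a] eval2_in[OF a] by (intro gauss_le_diff gauss_le_const) auto
    show "coeff2 ?Q 0 0 = 0"
      by (simp only: coeff2_0_0 P.diff poly2_const poly2_taylor2) simp
  qed
  then have "N (poly2 ?Q (x - a)) \<le> 1 / 2"
    by (rule N_poly2_le) (use a x in \<open>auto intro: diff_in\<close>)
  then show ?thesis by (simp add: P.diff poly2_const poly2_taylor2)
qed

section \<open>Analytic limits\<close>

text \<open>
  The values of the quotients form a geometric Cauchy sequence, since the denominators have absolute
  value 1. For analyticity at \<open>a\<close>, write the expansion of \<open>B s\<close> at \<open>a\<close> as \<open>b (1 - u)\<close> with a constant \<open>b\<close>
  of absolute value 1 and \<open>u\<close> of Gauss norm at most \<open>1/2\<close> on the polydisc of radius \<open>1/2\<close>. The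
  polynomial \<open>P s\<close>, the expansion of \<open>A s\<close> times the first \<open>s\<close> terms of the geometric series for
  \<open>1 / (b (1 - u))\<close>, differs from the quotient by at most \<open>1 / 2 ^ s\<close>. By the congruences, which hold
  coefficientwise, the \<open>P s\<close> form a Cauchy sequence for the Gauss norm, and the limits of their
  coefficients are the coefficients of the required power series.
\<close>
lemma ratio_cauchy_converges_to_analytic:
  fixes A B :: "nat \<Rightarrow> int poly poly"
  assumes complete: "complete_abs K N"
    and p: "N (of_nat p) \<le> 1 / 2"
    and char_0: "\<And>d::int. d \<noteq> 0 \<Longrightarrow> (of_int d :: 'a) \<noteq> 0"
    and D: "\<And>a k. a \<in> D \<Longrightarrow> a $ k \<in> K" "\<And>a k. a \<in> D \<Longrightarrow> N (a $ k) \<le> 1"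
    and D_open: "\<And>a x. a \<in> D \<Longrightarrow> (\<And>k. x $ k \<in> K) \<Longrightarrow> (\<And>k. N (x $ k - a $ k) < 1 / 2) \<Longrightarrow> x \<in> D"
    and B: "\<And>s a. s \<ge> s0 \<Longrightarrow> a \<in> D \<Longrightarrow> N (eval2 (B s) a) = 1"
    and ratio: "ratio_cauchy p s0 A B"
  shows "\<exists>f. nonarch_analytic_on K N D f \<and>
    uniform_limit D (\<lambda>s a. N (eval2 (A s) a / eval2 (B s) a - f a)) (\<lambda>_. 0) sequentially"
proof -
  obtain d :: int where "d \<noteq> 0" and ratio_d:
    "\<And>s. s \<ge> s0 \<Longrightarrow> of_nat p ^ s dvd of_int d * (A (Suc s) * B s - A s * B (Suc s))"
    using ratio by (auto simp: ratio_cauchy_def)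
  define \<delta> where "\<delta> = (of_int d :: 'a)"
  have \<delta>: "\<delta> \<noteq> 0" "\<delta> \<in> K" "N \<delta> > 0"
    using char_0[OF \<open>d \<noteq> 0\<close>] of_int_in N_nonneg[of \<delta>] N_eq_0[of \<delta>]
    by (auto simp: \<delta>_def less_le)
  \<comment> \<open>The bound \<open>1 / N \<delta>\<close> is that of the congruences; the bound 1 is for the truncation errors.\<close>
  define C where "C = max 1 (1 / N \<delta>)"
  have C: "C \<ge> 1" by (simp add: C_def)
  define cross where "cross s = A (Suc s) * B s - A s * B (Suc s)" for s
  have p_pow: "N (of_nat p ^ s) \<le> 1 / 2 ^ s" for s
    using power_mono[OF p N_nonneg[OF of_nat_in], of s] by (simp add: N_power of_nat_in power_divide)
  have taylor_cross: "gauss_le 1 (taylor2 a (cross s)) (C / 2 ^ s)" if a: "a \<in> D" and s: "s \<ge> s0" for a s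
  proof -
    interpret T: comm_ring_morphism "taylor2 a" by (rule taylor2_morphism)
    obtain R where R: "of_int d * cross s = of_nat p ^ s * R"
      using ratio_d[OF s] by (auto simp: cross_def dvd_def)
    have "of_int d * taylor2 a (cross s) = of_nat p ^ s * taylor2 a R"
      using arg_cong[OF R, of "taylor2 a"] by (simp add: T.mult T.of_int T.of_nat T.power)
    moreover have "(of_int d :: 'a poly poly) = [:[:\<delta>:]:]"
      by (simp add: of_int_poly \<delta>_def)
    moreover have "(of_nat p ^ s :: 'a poly poly) = [:[:of_nat p ^ s:]:]"
      by (simp add: of_nat_poly poly_const_pow)
    ultimately have "[:[:inverse \<delta>:]:] * ([:[:\<delta>:]:] * taylor2 a (cross s)) =
        [:[:inverse \<delta>:]:] * ([:[:of_nat p ^ s:]:] * taylor2 a R)" by simp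
    then have eq: "taylor2 a (cross s) = [:[:inverse \<delta> * of_nat p ^ s:]:] * taylor2 a R"
      unfolding const2_mult using \<delta>(1) by (simp add: one_pCons[symmetric])
    have "N (inverse \<delta> * of_nat p ^ s) = N (of_nat p ^ s) / N \<delta>"
      using \<delta> by (simp add: N_mult inverse_in power_in of_nat_in N_inverse divide_inverse)
    also have "\<dots> \<le> (1 / 2 ^ s) / N \<delta>" 
      by (rule divide_right_mono[OF p_pow]) (use \<delta>(3) in simp)
    also have "\<dots> \<le> C / 2 ^ s" by (simp add: C_def field_simps)
    finally have "gauss_le 1 [:[:inverse \<delta> * of_nat p ^ s:]:] (C / 2 ^ s)"
      using \<delta> C by (intro gauss_le_const mult_in inverse_in power_in of_nat_in) auto
    from gauss_le_mult[OF this gauss_le_taylor2[OF D[OF a]]] show ?thesis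
      unfolding eq using C by simp
  qed
  have N_cross: "N (eval2 (cross s) a) \<le> C / 2 ^ s" if "a \<in> D" "s \<ge> s0" for a s
    using gauss_leD[OF taylor_cross[OF that], of 0 0] by (simp add: coeff2_0_0 poly2_taylor2)
  define q where "q s a = eval2 (A s) a / eval2 (B s) a" for s and a :: "'a ^ 2"
  have q_in: "q s a \<in> K" if "a \<in> D" for s a
    unfolding q_def by (intro divide_in eval2_in D that)
  have B0: "eval2 (B s) a \<noteq> 0" if "a \<in> D" "s \<ge> s0" for s a
    using B[OF that(2,1)] by auto
  have q_step: "N (q (Suc s) a - q s a) \<le> C / 2 ^ s" if a: "a \<in> D" and s: "s \<ge> s0" for s a
  proof -
    interpret L: comm_ring_morphism "\<lambda>f. eval2 f a" by (rule eval2_morphism)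
    note [simp] = B0[OF a s] B0[OF a le_SucI[OF s]]
    have "q (Suc s) a - q s a = eval2 (cross s) a / (eval2 (B (Suc s)) a * eval2 (B s) a)"
      unfolding q_def cross_def by (simp add: L.diff L.mult divide_simps)
    then have "N (q (Suc s) a - q s a) = N (eval2 (cross s) a)"
      using B[OF s a] B[OF le_SucI[OF s] a] a
      by (simp add: N_divide N_mult mult_in eval2_in D)
    then show ?thesis using N_cross[OF a s] by simp
  qed
  define f where "f a = (SOME x. x \<in> K \<and> (\<forall>s\<ge>s0. N (x - q s a) \<le> C / 2 ^ s))" for a
  have f: "f a \<in> K \<and> (\<forall>s\<ge>s0. N (f a - q s a) \<le> C / 2 ^ s)" if "a \<in> D" for a
    unfolding f_def
    by (rule someI_ex) (use geometric_limit[OF complete, of "\<lambda>s. q s a" C s0] q_in q_step that C in auto)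
  have lim: "(\<lambda>s. C / 2 ^ s) \<longlonglongrightarrow> 0"
    using LIMSEQ_divide_realpow_zero[of 2 C] by simp
  have "uniform_limit D (\<lambda>s a. N (q s a - f a)) (\<lambda>_. 0) sequentially"
  proof (rule uniform_limitI)
    fix \<epsilon> :: real assume "\<epsilon> > 0"
    with lim have "\<forall>\<^sub>F s in sequentially. C / 2 ^ s < \<epsilon>" by (rule order_tendstoD)
    then show "\<forall>\<^sub>F s in sequentially. \<forall>a\<in>D. dist (N (q s a - f a)) 0 < \<epsilon>"
      using eventually_ge_at_top[of s0]
    proof eventually_elim
      case (elim s)
      have "dist (N (q s a - f a)) 0 < \<epsilon>" if "a \<in> D" for a
      proof -
        have "N (q s a - f a) = N (f a - q s a)"
          using f[OF that] q_in[OF that] by (intro N_diff_commute) auto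
        then show ?thesis using f[OF that] elim N_nonneg[of "q s a - f a"] q_in[OF that]
          by (fastforce simp: diff_in dist_real_def)
      qed
      then show ?case by blast
    qed
  qed
  moreover have "nonarch_analytic_on K N D f"
    unfolding nonarch_analytic_on_def
  proof
    fix a assume a: "a \<in> D"
    interpret T: comm_ring_morphism "taylor2 a" by (rule taylor2_morphism)
    note aK = D(1)[OF a] D(2)[OF a]
    define b where "b s = eval2 (B s) a" for s
    have b: "b s \<in> K" "N (b s) = 1" "b s \<noteq> 0" if "s \<ge> s0" for s
      using B[OF that a] B0[OF a that] eval2_in(1)[OF aK] by (simp_all add: b_def)
    define binv where "binv s = [:[:inverse (b s):]:]" for s
    have binv: "gauss_le \<rho> (binv s) 1" if "s \<ge> s0" "\<rho> \<ge> 1" for s \<rho>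
      unfolding binv_def using b[OF that(1)] that(2)
      by (intro gauss_le_const) (auto simp: inverse_in N_inverse)
    \<comment> \<open>\<open>V s\<close> is an approximate inverse of the expansion of \<open>B s\<close>, with error \<open>u s ^ s\<close>.\<close>
    define u where "u s = 1 - binv s * taylor2 a (B s)" for s
    define V where "V s = binv s * (\<Sum>k<s. u s ^ k)" for s
    define P where "P s = taylor2 a (A s) * V s" for s
    have u: "gauss_le 2 (u s) (1 / 2)" if s: "s \<ge> s0" for s
    proof (rule gauss_le_half)
      have "gauss_le 1 (binv s * taylor2 a (B s)) (1 * 1)"
        by (rule gauss_le_mult[OF binv[OF s] gauss_le_taylor2[OF aK]]) simp_all
      then show "gauss_le 1 (u s) 1" unfolding u_def by (intro gauss_le_diff gauss_le_1_1) simp_all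
      interpret P0: comm_ring_morphism "\<lambda>P. poly2 P (0 :: 'a ^ 2)" by (rule poly2_morphism)
      have "coeff2 (u s) 0 0 = 1 - inverse (b s) * b s"
        unfolding coeff2_0_0 u_def P0.diff P0.mult P0.one binv_def poly2_const poly2_taylor2 b_def
        by simp
      then show "coeff2 (u s) 0 0 = 0" using b[OF s] by simp
    qed
    have taylor_2: "gauss_le 2 (taylor2 a g) 1" for g
      by (rule gauss_le_mono[OF gauss_le_taylor2[OF aK]]) simp_all
    have V: "gauss_le 2 (V s) 1" if s: "s \<ge> s0" for s
    proof -
      have "gauss_le 2 (\<Sum>k<s. u s ^ k) 1"
      proof (rule gauss_le_sum)
        fix k
        have "gauss_le 2 (u s ^ k) ((1 / 2) ^ k)" using u[OF s] by (intro gauss_le_power) simp_all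
        then show "gauss_le 2 (u s ^ k) 1" by (rule gauss_le_mono) (simp_all add: power_le_one)
      qed simp_all
      from gauss_le_mult[OF binv[OF s] this] show ?thesis unfolding V_def by simp
    qed
    have VB: "V s * taylor2 a (B s) = 1 - u s ^ s" for s
    proof -
      have "V s * taylor2 a (B s) = (1 - u s) * (\<Sum>k<s. u s ^ k)"
        by (simp add: V_def u_def algebra_simps)
      then show ?thesis by (simp only: one_diff_power_eq)
    qed
    have us: "gauss_le 2 (u s ^ s) (1 / 2 ^ s)" if "s \<ge> s0" for s
      using gauss_le_power[OF u[OF that], of s] by (simp add: power_divide)
    have P1: "gauss_le 2 (P s) 1" if "s \<ge> s0" for s
      using gauss_le_mult[OF taylor_2 V[OF that]] by (simp add: P_def)
    have P_step: "gauss_le 2 (P (Suc s) - P s) (C / 2 ^ s)" if s: "s \<ge> s0" for s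
    proof -
      note s' = le_SucI[OF s]
      have "P (Suc s) - P s = taylor2 a (cross s) * (V s * V (Suc s))
          + (u s ^ s * P (Suc s) - u (Suc s) ^ Suc s * P s)"
      proof -
        have "taylor2 a (cross s) * (V s * V (Suc s)) =
            P (Suc s) * (V s * taylor2 a (B s)) - P s * (V (Suc s) * taylor2 a (B (Suc s)))"
          by (simp add: cross_def T.diff T.mult P_def algebra_simps)
        then show ?thesis unfolding VB by (simp add: algebra_simps)
      qed
      moreover have "gauss_le 2 (taylor2 a (cross s) * (V s * V (Suc s))) (C / 2 ^ s * (1 * 1))"
        using C by (intro gauss_le_mult V s s' gauss_le_mono[OF taylor_cross[OF a s]]) simp_all
      moreover have "gauss_le 2 (u s ^ s * P (Suc s)) (C / 2 ^ s)"
        using gauss_le_mult[OF us[OF s] P1[OF s']] C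
        by (auto elim!: gauss_le_mono simp: divide_right_mono)
      moreover have "gauss_le 2 (u (Suc s) ^ Suc s * P s) (C / 2 ^ s)"
      proof (rule gauss_le_mono[OF gauss_le_mult[OF us[OF s'] P1[OF s]]])
        have "(1::real) / 2 ^ Suc s * 1 \<le> 1 / 2 ^ s" by (simp add: field_simps)
        also have "\<dots> \<le> C / 2 ^ s" using C by (simp add: divide_right_mono)
        finally show "(1::real) / 2 ^ Suc s * 1 \<le> C / 2 ^ s" .
      qed simp_all
      ultimately show ?thesis by (simp add: gauss_le_add gauss_le_diff)
    qed
    \<comment> \<open>The bounds on \<open>P s\<close> hold from \<open>s0\<close> on only, hence the maximum.\<close>
    have c_ex: "\<exists>c\<in>K. \<forall>s\<ge>s0. N (c - coeff2 (P (max s s0)) i j) \<le> 2 ^ (i + j) * C / 2 ^ s" for i j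
    proof (rule geometric_limit[OF complete])
      show "coeff2 (P (max n s0)) i j \<in> K" for n by (rule gauss_le_in[OF P1]) simp
      show "0 \<le> 2 ^ (i + j) * C" using C by simp
      fix s assume "s \<ge> s0"
      then show "N (coeff2 (P (max (Suc s) s0)) i j - coeff2 (P (max s s0)) i j) \<le> 2 ^ (i + j) * C / 2 ^ s"
        using gauss_leD[OF P_step, of s, where i = i and j = j] by (simp add: max_absorb1 mult.commute)
    qed
    define c where "c i j = (SOME c. c \<in> K \<and>
      (\<forall>s\<ge>s0. N (c - coeff2 (P (max s s0)) i j) \<le> 2 ^ (i + j) * C / 2 ^ s))" for i j
    have c': "c i j \<in> K \<and>
      (\<forall>s\<ge>s0. N (c i j - coeff2 (P (max s s0)) i j) \<le> 2 ^ (i + j) * C / 2 ^ s)" for i j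
      unfolding c_def by (rule someI_ex) (rule c_ex[where i = i and j = j, unfolded Bex_def])
    then have c: "c i j \<in> K" for i j by blast
    have cP: "N (c i j - coeff2 (P s) i j) \<le> 2 ^ (i + j) * C / 2 ^ s" if "s \<ge> s0" for i j s
    proof -
      have "N (c i j - coeff2 (P (max s s0)) i j) \<le> 2 ^ (i + j) * C / 2 ^ s"
        using c'[where i = i and j = j, THEN conjunct2, rule_format, OF that] .
      then show ?thesis by (simp only: max_absorb1[OF that])
    qed
    have P_val: "N (f x - poly2 (P s) (x - a)) \<le> C / 2 ^ s"
      if x: "\<And>k. x $ k \<in> K" "\<And>k. N (x $ k - a $ k) < 1 / 2" and s: "s \<ge> s0" for x s
    proof -
      have xD: "x \<in> D" using D_open[OF a x] .
      interpret y: comm_ring_morphism "\<lambda>P. poly2 P (x - a)" by (rule poly2_morphism)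
      note [simp] = B0[OF xD s]
      have yK: "(x - a) $ k \<in> K" "N ((x - a) $ k) \<le> 1 / 2" for k
        using x aK by (auto simp: diff_in less_imp_le)
      have BV: "poly2 (V s) (x - a) * eval2 (B s) x = 1 - poly2 (u s ^ s) (x - a)"
        using arg_cong[OF VB[of s], of "\<lambda>P. poly2 P (x - a)"]
        by (simp add: y.mult y.diff y.one poly2_taylor2)
      have "q s x - poly2 (P s) (x - a) = q s x * (1 - poly2 (V s) (x - a) * eval2 (B s) x)"
        by (simp add: q_def P_def y.mult poly2_taylor2 field_simps)
      then have "N (q s x - poly2 (P s) (x - a)) = N (q s x) * N (poly2 (u s ^ s) (x - a))"
        unfolding BV using N_poly2_le(2)[OF us[OF s] _ yK] q_in[OF xD] by (simp add: N_mult)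
      also have "N (q s x) = N (eval2 (A s) x)"
        using B[OF s xD] by (simp add: q_def N_divide eval2_in D xD)
      also have "N (eval2 (A s) x) * N (poly2 (u s ^ s) (x - a)) \<le> 1 * (1 / 2 ^ s)"
        using eval2_in[OF D(1)[OF xD] D(2)[OF xD]] N_poly2_le(1,2)[OF us[OF s] _ yK]
        by (intro mult_mono N_nonneg) auto
      also have "\<dots> \<le> C / 2 ^ s" using C by (simp add: divide_right_mono)
      finally have 1: "N (q s x - poly2 (P s) (x - a)) \<le> C / 2 ^ s" .
      have "f x - poly2 (P s) (x - a) = (f x - q s x) + (q s x - poly2 (P s) (x - a))" by simp
      then show ?thesis
        using N_add_le[OF _ _ _ 1, of "f x - q s x"] f[OF xD] s q_in[OF xD]
          N_poly2_le(2)[OF P1[OF s] _ yK] by (simp add: diff_in)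
    qed
    have "x \<in> D \<and> f x \<in> K \<and>
        ((\<lambda>F. N (f x - (\<Sum>(i, j)\<in>F. c i j * (x $ 1 - a $ 1) ^ i * (x $ 2 - a $ 2) ^ j)))
           \<longlongrightarrow> 0) (finite_subsets_at_top UNIV)"
      if "\<forall>k. x $ k \<in> K \<and> N (x $ k - a $ k) < 1 / 2" for x
    proof -
      have x: "x $ k \<in> K" "N (x $ k - a $ k) < 1 / 2" for k using that by auto
      have xD: "x \<in> D" using D_open[OF a x] .
      let ?y = "x - a"
      have yK: "?y $ k \<in> K" "N (?y $ k) \<le> 1 / 2" for k
        using x aK by (auto simp: diff_in less_imp_le)
      let ?S = "\<lambda>F. \<Sum>(i, j)\<in>F. c i j * (?y $ 1) ^ i * (?y $ 2) ^ j"
      have S_in: "?S F \<in> K" for F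
        using c yK by (intro sum_in) (auto intro!: mult_in power_in)
      have "((\<lambda>F. N (f x - ?S F)) \<longlongrightarrow> 0) (finite_subsets_at_top UNIV)"
      proof (rule tendstoI)
        fix \<epsilon> :: real assume "\<epsilon> > 0"
        with lim have "\<forall>\<^sub>F s in sequentially. C / 2 ^ s < \<epsilon>" by (rule order_tendstoD)
        then have "\<forall>\<^sub>F s in sequentially. C / 2 ^ s < \<epsilon> \<and> s \<ge> s0"
          using eventually_ge_at_top by (rule eventually_conj)
        then obtain s where s: "C / 2 ^ s < \<epsilon>" "s \<ge> s0"
          unfolding eventually_sequentially by blast
        let ?SP = "\<lambda>F. \<Sum>(i, j)\<in>F. coeff2 (P s) i j * (?y $ 1) ^ i * (?y $ 2) ^ j"
        obtain F0 where F0: "finite F0" "\<And>F. finite F \<Longrightarrow> F0 \<subseteq> F \<Longrightarrow> poly2 (P s) ?y = ?SP F"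
          using poly2_eq_sum[of "P s" ?y] by blast
        have "dist (N (f x - ?S F)) 0 < \<epsilon>" if F: "finite F" "F0 \<subseteq> F" for F
        proof -
          have diff_eq: "?SP F - ?S F =
              (\<Sum>(i, j)\<in>F. (coeff2 (P s) i j - c i j) * (?y $ 1) ^ i * (?y $ 2) ^ j)"
            by (simp add: sum_subtractf[symmetric] split_beta algebra_simps)
          have bound: "(coeff2 (P s) i j - c i j) * (?y $ 1) ^ i * (?y $ 2) ^ j \<in> K"
            "N ((coeff2 (P s) i j - c i j) * (?y $ 1) ^ i * (?y $ 2) ^ j) \<le> C / 2 ^ s" for i j
          proof -
            have dK: "coeff2 (P s) i j - c i j \<in> K"
              using c gauss_le_in[OF P1[OF s(2)]] by (intro diff_in)
            then show "(coeff2 (P s) i j - c i j) * (?y $ 1) ^ i * (?y $ 2) ^ j \<in> K"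
              by (intro mult_in power_in yK)
            have "N (coeff2 (P s) i j - c i j) \<le> 2 ^ (i + j) * C / 2 ^ s"
              using cP[OF s(2), of i j] N_diff_commute[OF c gauss_le_in[OF P1[OF s(2)]]] by simp
            then have "N ((coeff2 (P s) i j - c i j) * (?y $ 1) ^ i * (?y $ 2) ^ j)
                \<le> (2 ^ (i + j) * C / 2 ^ s) * (1 / 2) ^ i * (1 / 2) ^ j"
              using dK yK C N_nonneg
              by (simp only: N_mult N_power mult_in power_in) (intro mult_mono power_mono; simp)
            also have "\<dots> = C / 2 ^ s" by (simp add: power_add power_divide)
            finally show "N ((coeff2 (P s) i j - c i j) * (?y $ 1) ^ i * (?y $ 2) ^ j) \<le> C / 2 ^ s" .
          qed
          have "N (?SP F - ?S F) \<le> C / 2 ^ s" "?SP F - ?S F \<in> K"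
            unfolding diff_eq using C by (auto intro!: N_sum_le sum_in bound[simplified])
          moreover have "N (f x - ?SP F) \<le> C / 2 ^ s" 
            using P_val[OF x s(2)] F0(2)[OF F] by simp
          moreover have "f x - ?SP F \<in> K"
            using f[OF xD] N_poly2_le(2)[OF P1[OF s(2)] _ yK] F0(2)[OF F] by (simp add: diff_in)
          ultimately have "N ((f x - ?SP F) + (?SP F - ?S F)) \<le> C / 2 ^ s" by (intro N_add_le)
          then have "N (f x - ?S F) \<le> C / 2 ^ s" by simp
          then show ?thesis
            using s N_nonneg[of "f x - ?S F"] f[OF xD] S_in by (simp add: dist_real_def diff_in)
        qed
        then show "\<forall>\<^sub>F F in finite_subsets_at_top UNIV. dist (N (f x - ?S F)) 0 < \<epsilon>"
          unfolding eventually_finite_subsets_at_top using F0(1) by blast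
      qed
      then show ?thesis using xD f[OF xD] by simp
    qed
    then show "\<exists>r>0. \<exists>c :: nat \<Rightarrow> nat \<Rightarrow> 'a. (\<forall>i j. c i j \<in> K) \<and>
        (\<forall>x. (\<forall>k. x $ k \<in> K \<and> N (x $ k - a $ k) < r) \<longrightarrow>
           x \<in> D \<and> f x \<in> K \<and>
           ((\<lambda>F. N (f x - (\<Sum>(i, j)\<in>F. c i j * (x $ 1 - a $ 1) ^ i * (x $ 2 - a $ 2) ^ j)))
              \<longlongrightarrow> 0) (finite_subsets_at_top UNIV))"
      using c by (intro exI[of _ "1 / 2 :: real"] conjI exI[of _ c]) auto
  qed
  ultimately show ?thesis unfolding q_def by blast
qed

end

section \<open>The digits of minus one half lambda\<close>

lemma nonarch_field_padic_numbers:
  assumes "padic_numbers p v"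
  shows "nonarch_field UNIV v"
  using assms by (simp add: nonarch_field_def padic_numbers_def subfield_of_def)

lemma padic_numbers_abs_p:
  assumes "padic_numbers p v" and "prime p"
  shows "v (of_nat p) = 1 / p"
proof -
  have p: "p > 1" using assms(2) prime_gt_1_nat by blast
  have "v (of_rat (of_int (int p))) = padic_abs_rat p (of_int (int p))"
    using assms(1) unfolding padic_numbers_def by blast
  also have "\<dots> = real p powi (- 1)"
    using p assms(2) by (simp add: padic_abs_rat_def)
  finally show ?thesis by (simp add: power_int_minus divide_inverse)
qed

lemma padic_numbers_abs_unit:
  assumes "padic_numbers p v" and "prime p" and "\<not> int p dvd m"
  shows "v (of_int m) = 1"
proof -
  have p: "p > 1" using assms(2) prime_gt_1_nat by blast
  have m: "m \<noteq> 0" using assms(3) by auto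
  have "v (of_rat (of_int m)) = padic_abs_rat p (of_int m)"
    using assms(1) unfolding padic_numbers_def by blast
  also have "\<dots> = 1"
    using p m assms(3)
    by (simp add: padic_abs_rat_def not_dvd_imp_multiplicity_0)
  finally show ?thesis by simp
qed

lemma digit_expansion_difference:
  fixes w w' :: "nat \<Rightarrow> nat"
  assumes "\<And>i. i < i0 \<Longrightarrow> w i = w' i" and "n > i0"
  shows "int p ^ Suc i0 dvd (\<Sum>i<n. (int (w i) - int (w' i)) * int p ^ i)
    - (int (w i0) - int (w' i0)) * int p ^ i0"
proof -
  from assms(2) have "Suc i0 \<le> n" by simp
  then show ?thesis
  proof (induction n rule: dec_induct)
    case base
    show ?case using assms(1) by simp
  next
    case (step n)
    have eq: "(\<Sum>i<Suc n. (int (w i) - int (w' i)) * int p ^ i) - (int (w i0) - int (w' i0)) * int p ^ i0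
      = ((\<Sum>i<n. (int (w i) - int (w' i)) * int p ^ i) - (int (w i0) - int (w' i0)) * int p ^ i0)
        + (int (w n) - int (w' n)) * int p ^ n" by simp
    have "int p ^ Suc i0 dvd (int (w n) - int (w' n)) * int p ^ n"
      using step(1) by (intro dvd_mult le_imp_power_dvd)
    then show ?case unfolding eq by (rule dvd_add[OF step.IH])
  qed
qed

text \<open>
  If two digit sequences differ first at \<open>i\<close>, then all later partial sums differ by \<open>p ^ i\<close> times a
  unit, so that they cannot have the same limit. The rational numbers are embedded into the \<open>p\<close>-adic
  ones in order to have a multiplicative ultrametric absolute value at hand.
\<close>
lemma padic_digits_eqI:
  fixes v :: "'q::field_char_0 \<Rightarrow> real"
  assumes v: "padic_numbers p v" and p: "prime p" and w: "\<And>i. w i \<le> p - 1"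
    and lim: "(\<lambda>n. padic_abs_rat p (x - (\<Sum>i<n. of_nat (w i) * of_nat p ^ i))) \<longlonglongrightarrow> 0"
  shows "padic_digits p x = w"
  unfolding padic_digits_def
proof (rule the_equality)
  fix w' assume w': "(\<forall>i. w' i \<le> p - 1) \<and>
    (\<lambda>n. padic_abs_rat p (x - (\<Sum>i<n. of_nat (w' i) * of_nat p ^ i))) \<longlonglongrightarrow> 0"
  interpret Q: nonarch_field UNIV v by (rule nonarch_field_padic_numbers[OF v])
  have p1: "p > 1" using p prime_gt_1_nat by blast
  have abs: "padic_abs_rat p r = v (of_rat r)" for r
    using v by (simp add: padic_numbers_def)
  show "w' = w"
  proof (rule ccontr)
    assume "w' \<noteq> w"
    then have ex: "\<exists>i. w i \<noteq> w' i" by auto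
    define i0 where "i0 = (LEAST i. w i \<noteq> w' i)"
    have i0: "w i0 \<noteq> w' i0" unfolding i0_def using ex by (rule LeastI_ex)
    have below: "w i = w' i" if "i < i0" for i
      using not_less_Least[of i "\<lambda>i. w i \<noteq> w' i"] that by (auto simp: i0_def)
    define d where "d = int (w i0) - int (w' i0)"
    have "\<bar>d\<bar> < int p" "d \<noteq> 0"
      using w[of i0] w'[THEN conjunct1, rule_format, of i0] i0 p1 by (auto simp: d_def)
    then have pd: "\<not> int p dvd d" using zdvd_not_zless[of "\<bar>d\<bar>" "int p"] by auto
    let ?r = "\<lambda>w n. x - (\<Sum>i<n. of_nat (w i) * of_nat p ^ i)"
    have size: "(1 / real p) ^ i0 \<le> v (of_rat (?r w' n)) + v (of_rat (?r w n))" if n: "n > i0" for n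
    proof -
      let ?E = "\<Sum>i<n. (int (w i) - int (w' i)) * int p ^ i"
      obtain R where "?E - d * int p ^ i0 = int p ^ Suc i0 * R"
        using digit_expansion_difference[of i0 w w' n p] below n by (auto simp: d_def dvd_def)
      then have E: "?E = int p ^ i0 * (d + int p * R)" by (simp add: algebra_simps)
      have "\<not> int p dvd d + int p * R" using pd by (simp add: dvd_add_left_iff)
      then have "v (of_int (d + int p * R)) = 1" by (rule padic_numbers_abs_unit[OF v p])
      then have "v (of_int ?E) = (1 / real p) ^ i0"
        unfolding E using padic_numbers_abs_p[OF v p]
        by (simp add: Q.N_mult Q.N_power del: of_int_add)
      moreover have "of_int ?E = of_rat (?r w' n) - (of_rat (?r w n) :: 'q)"
        by (simp add: of_rat_diff sum_subtractf left_diff_distrib of_rat_sum of_rat_mult of_rat_power)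
      moreover have "v (of_rat (?r w' n) - of_rat (?r w n)) \<le> max (v (of_rat (?r w' n))) (v (of_rat (?r w n)))"
        by (rule Q.N_diff) simp_all
      moreover have "v (of_rat (?r w' n)) \<ge> 0" "v (of_rat (?r w n)) \<ge> 0"
        by (simp_all add: Q.N_nonneg)
      ultimately show ?thesis by simp
    qed
    have "(\<lambda>n. v (of_rat (?r w' n)) + v (of_rat (?r w n))) \<longlonglongrightarrow> 0 + 0"
      using lim w' unfolding abs by (intro tendsto_add) auto
    then have "(1 / real p) ^ i0 \<le> 0 + 0"
      by (rule LIMSEQ_le_const) (use size in \<open>auto intro!: exI[of _ "Suc i0"]\<close>)
    moreover have "(1 / real p) ^ i0 > 0" using p1 by simp
    ultimately show False by simp
  qed
qed (use w lim in simp)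

lemma sum_digits_eq_mod: "(\<Sum>i<n. (M div p ^ i mod p) * p ^ i) = M mod p ^ n" for M p :: nat
proof (induction n)
  case (Suc n)
  have "M mod p ^ Suc n = p ^ n * (M div p ^ n mod p) + M mod p ^ n"
    by (simp only: power_Suc2 mod_mult2_eq)
  then show ?case using Suc by simp
qed simp

text \<open>
  From \<open>-1/2 = (p - 1) / 2 * (1 + p + p\<^sup>2 + \<dots>)\<close> and
  \<open>- lam / 2 = (p ^ e - lam) / 2 + p ^ e * (- 1/2)\<close>, where the first summand is an integer in the range of \<open>e\<close>
  digits: its digits are followed by the constant digit \<open>(p - 1) / 2\<close>.
\<close>
lemma digits_of_half_odd:
  fixes v :: "'q::field_char_0 \<Rightarrow> real"
  assumes v: "padic_numbers p v" and p: "prime p" "odd p"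
    and lam: "odd lam" "- (int p ^ e) < lam" "lam < int p ^ e"
  obtains w where "\<And>i. w i \<le> p - 1" and "digit_set p lam = range w"
    and "\<And>s. s \<ge> e \<Longrightarrow> nat ((int p ^ s - lam) div 2) = (\<Sum>i<s. w i * p ^ i)"
proof -
  have p1: "p > 1" using p prime_gt_1_nat by blast
  define M where "M = nat ((int p ^ e - lam) div 2)"
  have "odd (int p ^ e)" using p(2) by simp
  then have "even (int p ^ e - lam)" using lam(1) by simp
  then have "2 * ((int p ^ e - lam) div 2) = int p ^ e - lam" by simp
  moreover have "(int p ^ e - lam) div 2 \<ge> 0" using lam by simp
  ultimately have M2: "2 * int M = int p ^ e - lam" by (simp add: M_def)
  have "2 * int M < 2 * int (p ^ e)" using M2 lam(2) by simp
  then have M: "M < p ^ e" by linarith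
  define w where "w i = (if i < e then M div p ^ i mod p else (p - 1) div 2)" for i
  have w: "w i \<le> p - 1" for i
    using p1 mod_less_divisor[of p "M div p ^ i"] by (auto simp: w_def less_Suc_eq_le[symmetric])
  have exp2: "2 * int (\<Sum>i<s. w i * p ^ i) = int p ^ s - lam" if "s \<ge> e" for s
    using that
  proof (induction s rule: dec_induct)
    case base
    have "(\<Sum>i<e. w i * p ^ i) = (\<Sum>i<e. (M div p ^ i mod p) * p ^ i)"
      by (intro sum.cong) (simp_all add: w_def)
    then show ?case using M M2 by (simp add: sum_digits_eq_mod)
  next
    case (step s)
    obtain h where h: "p = 2 * h + 1" using p(2) by (rule oddE)
    have "w s = h" using step(1) by (simp add: w_def h)
    then have "2 * int (\<Sum>i<Suc s. w i * p ^ i) = int p ^ s - lam + 2 * int h * int p ^ s"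
      using step.IH by (simp add: algebra_simps)
    also have "\<dots> = (2 * int h + 1) * int p ^ s - lam" by (simp add: algebra_simps)
    also have "2 * int h + 1 = int p" by (simp add: h)
    finally show ?case by simp
  qed
  have "padic_digits p (- of_int lam / 2) = w"
  proof (rule padic_digits_eqI[OF v p(1) w])
    interpret Q: nonarch_field UNIV v by (rule nonarch_field_padic_numbers[OF v])
    have "padic_abs_rat p (- of_int lam / 2 - (\<Sum>i<s. of_nat (w i) * of_nat p ^ i))
        = (1 / real p) ^ s * v (- inverse 2)" if s: "s \<ge> e" for s
    proof -
      have "of_int (2 * int (\<Sum>i<s. w i * p ^ i)) = (of_int (int p ^ s - lam) :: rat)"
        using exp2[OF s] by (simp only:)
      then have "2 * (\<Sum>i<s. of_nat (w i) * of_nat p ^ i) = (of_nat p ^ s - of_int lam :: rat)" by simp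
      then have "- of_int lam / 2 - (\<Sum>i<s. of_nat (w i) * of_nat p ^ i) = (of_nat p ^ s * - inverse 2 :: rat)"
        by (simp add: field_simps)
      moreover have "padic_abs_rat p r = v (of_rat r)" for r
        using v by (simp add: padic_numbers_def)
      ultimately show ?thesis
        using padic_numbers_abs_p[OF v p(1)]
        by (simp only: of_rat_mult of_rat_power of_rat_of_nat_eq of_rat_minus of_rat_inverse
            of_rat_numeral_eq Q.N_mult[OF UNIV_I UNIV_I] Q.N_power[OF UNIV_I])
    qed
    then have ev: "\<forall>\<^sub>F s in sequentially. (1 / real p) ^ s * v (- inverse 2) =
        padic_abs_rat p (- of_int lam / 2 - (\<Sum>i<s. of_nat (w i) * of_nat p ^ i))"
      unfolding eventually_sequentially by metis
    have "(\<lambda>s. (1 / real p) ^ s) \<longlonglongrightarrow> 0" using p1 by (intro LIMSEQ_power_zero) simp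
    then have "(\<lambda>s. (1 / real p) ^ s * v (- inverse 2)) \<longlonglongrightarrow> 0"
      by (rule tendsto_mult_left_zero)
    then show "(\<lambda>s. padic_abs_rat p (- of_int lam / 2 - (\<Sum>i<s. of_nat (w i) * of_nat p ^ i))) \<longlonglongrightarrow> 0"
      using ev by (rule Lim_transform_eventually)
  qed
  then have "digit_set p lam = range w" by (simp add: digit_set_def)
  moreover have "nat ((int p ^ s - lam) div 2) = (\<Sum>i<s. w i * p ^ i)" if "s \<ge> e" for s
  proof -
    have "nat (2 * int k div 2) = k" for k by simp
    then show ?thesis unfolding exp2[OF that, symmetric] .
  qed
  ultimately show thesis using w that by blast
qed

section \<open>The denominators on the domain\<close>

context nonarch_field
begin

lemma eval2_dvd_le:
  assumes "\<And>k. a $ k \<in> K" "\<And>k. N (a $ k) \<le> 1" and "of_nat p dvd f"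
  shows "N (eval2 f a) \<le> N (of_nat p)"
proof -
  interpret E: comm_ring_morphism "\<lambda>f. eval2 f a" by (rule eval2_morphism)
  obtain g where g: "f = of_nat p * g" using assms(3) by blast
  have "N (eval2 f a) = N (of_nat p) * N (eval2 g a)"
    using eval2_in[OF assms(1,2)] by (simp add: g E.mult E.of_nat N_mult of_nat_in)
  also have "\<dots> \<le> N (of_nat p) * 1"
    using eval2_in[OF assms(1,2)] by (intro mult_left_mono N_nonneg of_nat_in) auto
  finally show ?thesis by simp
qed

text \<open>
  By \<open>p_dvd_dwork_coeff_Suc_diff\<close> the coefficient is, modulo \<open>p\<close>, a product of powers of the values
  of \<open>hpol\<close> at the digits.
\<close>
lemma N_eval2_dwork_coeff:
  assumes p: "prime p" "odd p" "N (of_nat p) < 1"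
    and a: "\<And>k. a $ k \<in> K" "\<And>k. N (a $ k) \<le> 1"
    and w: "\<And>i. w i \<le> p - 1" and h: "\<And>i. N (eval2 (hpol p (w i)) a) = 1"
  shows "N (eval2 (dwork_coeff p (\<lambda>i. digit_poly p (w i)) n) a) = 1"
  using w h
proof (induction n arbitrary: w)
  case 0
  interpret E: comm_ring_morphism "\<lambda>f. eval2 f a" by (rule eval2_morphism)
  show ?case by (simp add: dwork_coeff_def E.one)
next
  case (Suc n)
  interpret E: comm_ring_morphism "\<lambda>f. eval2 f a" by (rule eval2_morphism)
  interpret F: frobenius_lift "frob2 p" p by (rule frobenius_lift_frob2[OF p(1,2)])
  let ?f = "dwork_coeff p (\<lambda>i. digit_poly p (w i)) (Suc n)"
  let ?T = "dwork_coeff p (\<lambda>i. digit_poly p (w (Suc i))) n"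
  let ?g = "hpol p (w 0) * ?T ^ p"
  note in_K = eval2_in[OF a]
  have "of_nat p dvd ?f - ?g"
    using F.p_dvd_dwork_coeff_Suc_diff[OF degree_digit_poly_le, of "\<lambda>i. w i" n] Suc.prems(1)
    by (simp add: hpol_def digit_poly_def)
  then have small: "N (eval2 ?f a - eval2 ?g a) < 1"
    using eval2_dvd_le[OF a, of p "?f - ?g"] p(3) by (simp add: E.diff)
  have "N (eval2 ?T a) = 1" using Suc.IH[of "\<lambda>i. w (Suc i)"] Suc.prems by simp
  then have g: "N (eval2 ?g a) = 1"
    using Suc.prems(2)[of 0] by (simp add: E.mult E.power N_mult N_power in_K power_in)
  have "eval2 ?g a = eval2 ?f a - (eval2 ?f a - eval2 ?g a)" by simp
  then have "N (eval2 ?g a) \<le> max (N (eval2 ?f a)) (N (eval2 ?f a - eval2 ?g a))"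
    using N_diff[of "eval2 ?f a" "eval2 ?f a - eval2 ?g a"] in_K by (simp add: diff_in)
  then have "N (eval2 ?f a) \<ge> 1" using g small by linarith
  then show ?case using in_K(2)[of ?f] by simp
qed

text \<open>
  No factor has absolute value greater than 1.
\<close>
lemma N_eval2_factor_eq_1:
  assumes a: "\<And>k. a $ k \<in> K" "\<And>k. N (a $ k) \<le> 1"
    and "finite S" "w \<in> S" and "N (eval2 (\<Prod>w\<in>S. h w) a) = 1"
  shows "N (eval2 (h w) a) = 1"
proof -
  interpret E: comm_ring_morphism "\<lambda>f. eval2 f a" by (rule eval2_morphism)
  let ?r = "\<Prod>w\<in>S - {w}. h w"
  have "(\<Prod>w\<in>S. h w) = h w * ?r" using assms(3,4) by (simp add: prod.remove)
  then have "N (eval2 (h w) a) * N (eval2 ?r a) = 1"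
    using assms(5) eval2_in[OF a] by (simp add: E.mult N_mult)
  moreover have "N (eval2 (h w) a) * N (eval2 ?r a) \<le> N (eval2 (h w) a) * 1"
    using eval2_in[OF a] by (intro mult_left_mono N_nonneg) auto
  ultimately show ?thesis using eval2_in(2)[OF a, of "h w"] by simp
qed

lemma converges_to_analyticI:
  assumes "\<And>s a. s \<ge> s0 \<Longrightarrow> a \<in> D \<Longrightarrow> eval2 (B s) a \<noteq> 0"
    and "\<And>k. \<exists>f. nonarch_analytic_on K N D f \<and>
      uniform_limit D (\<lambda>s a. N (eval2 (A s $ k) a / eval2 (B s) a - f a)) (\<lambda>_. 0) sequentially"
  shows "converges_to_analytic K N D s0 A B"
proof -
  obtain f where f: "\<forall>k. nonarch_analytic_on K N D (f k) \<and>
      uniform_limit D (\<lambda>s a. N (eval2 (A s $ k) a / eval2 (B s) a - f k a)) (\<lambda>_. 0) sequentially"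
    using choice[OF allI[OF assms(2)]] by (rule exE)
  then show ?thesis
    unfolding converges_to_analytic_def using assms(1)
    by (intro conjI exI[of _ "\<lambda>a. \<chi> k. f k a"]) auto
qed

end

theorem theorem5p4:
  fixes p m e :: nat and lam :: int
    and v :: "'q::field_char_0 \<Rightarrow> real"
    and K :: "'q alg_closure set" and N :: "'q alg_closure \<Rightarrow> real"
  assumes "prime p" and "odd p" and "m > 0" and "e > 0"
    and "odd lam" and "- (int p ^ e) < lam" and "lam < int p ^ e"
    and "padic_numbers p v" and "unramified_extension v m K N"
  shows
        "converges_to_analytic K N (Ddom p K N lam) e
           (\<lambda>s. Ivec p s lam) (\<lambda>s. Tpol p s lam) \<and>
         converges_to_analytic K N (Ddom p K N lam) (2 * e + 1)
           (\<lambda>s. Ivec p s (lam + 2)) (\<lambda>s. Tpol p s lam) \<and>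
         (\<forall>j. converges_to_analytic K N (Ddom p K N lam) e
           (\<lambda>s. dIvec j p s lam) (\<lambda>s. Tpol p s lam))"
proof -
  note p = \<open>prime p\<close> \<open>odd p\<close>
  interpret nonarch_field K N
    using assms(9) by unfold_locales (simp_all add: unramified_extension_def)
  let ?D = "Ddom p K N lam"
  obtain w where w: "\<And>i. w i \<le> p - 1" and digits: "digit_set p lam = range w"
    and expansion: "\<And>s. s \<ge> e \<Longrightarrow> nat ((int p ^ s - lam) div 2) = (\<Sum>i<s. w i * p ^ i)"
    using digits_of_half_odd[OF assms(8) p assms(5-7)] by blast
  have p2: "p \<ge> 2" using p(1) prime_ge_2_nat by blast
  have Nto: "N (to_ac x) = v x" for x
    using assms(9) by (simp add: unramified_extension_def)
  have "N (of_nat p) = 1 / p"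
    using Nto[of "of_nat p"] padic_numbers_abs_p[OF assms(8) p(1)] by simp
  then have Np: "N (of_nat p) \<le> 1 / 2" using frac_le[of 1 1 2 "real p"] p2 by simp
  have char_0: "(of_int d :: 'q alg_closure) \<noteq> 0" if "d \<noteq> 0" for d
    using that to_ac_eq_0_iff[of "of_int d :: 'q"] by simp
  have complete: "complete_abs K N"
    by (rule complete_abs_unramified_extension[OF assms(8,9,3)])
  have D: "a $ k \<in> K" "N (a $ k) \<le> 1" if "a \<in> ?D" for a k
    using that by (auto simp: Ddom_def)
  have D_open: "x \<in> ?D" if a: "a \<in> ?D" and x: "\<And>k. x $ k \<in> K" "\<And>k. N (x $ k - a $ k) < 1 / 2" for a x
  proof -
    have x1: "N (x $ k) \<le> 1" for k
      using N_add_le[of "x $ k - a $ k" "a $ k" 1] x[of k] D[OF a, of k] by (simp add: diff_in)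
    let ?H = "eval2 (Hpol p lam)"
    have small: "N (?H x - ?H a) < 1"
      using x by (intro N_eval2_diff_less D[OF a]) (auto simp: less_imp_le)
    have in_K: "?H x \<in> K" "?H a \<in> K" "N (?H x) \<le> 1"
      using eval2_in[OF x(1) x1] eval2_in[OF D[OF a]] by auto
    have "?H a = ?H x - (?H x - ?H a)" by simp
    then have "N (?H a) \<le> max (N (?H x)) (N (?H x - ?H a))"
      using N_diff[of "?H x" "?H x - ?H a"] in_K by (simp add: diff_in)
    moreover have "N (?H a) = 1" using a by (simp add: Ddom_def)
    ultimately have "N (?H x) = 1" using small in_K(3) by linarith
    then show ?thesis using x x1 by (simp add: Ddom_def)
  qed
  have finite: "finite (range w)"
    by (rule finite_subset[of _ "{..p - 1}"]) (use w in auto)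
  have T_unit: "N (eval2 (dwork_coeff p (\<lambda>i. digit_poly p (w (l + i))) n) a) = 1" if a: "a \<in> ?D" for a l n
  proof (rule N_eval2_dwork_coeff[OF p _ D[OF a]])
    show "N (eval2 (hpol p (w (l + i))) a) = 1" for i
      by (rule N_eval2_factor_eq_1[OF D[OF a] finite])
        (use a digits in \<open>simp_all add: Ddom_def Hpol_def\<close>)
  qed (use Np w in auto)
  have B: "N (eval2 (Tpol p s lam) a) = 1" if "s \<ge> e" "a \<in> ?D" for s a
    using T_unit[OF that(2), of 0] Tpol_eq_dwork_coeff[OF p(2) expansion[OF that(1)]] by simp
  have main: "converges_to_analytic K N ?D s0 A (\<lambda>s. Tpol p s lam)"
    if "s0 \<ge> e" and "?D \<noteq> {} \<Longrightarrow> \<forall>k. ratio_cauchy p e (\<lambda>s. A s $ k) (\<lambda>s. Tpol p s lam)" for s0 A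
  proof (rule converges_to_analyticI)
    show "eval2 (Tpol p s lam) a \<noteq> 0" if "s \<ge> s0" "a \<in> ?D" for s a
      using B[of s a] that \<open>s0 \<ge> e\<close> by auto
    show "\<exists>f. nonarch_analytic_on K N ?D f \<and>
      uniform_limit ?D (\<lambda>s a. N (eval2 (A s $ k) a / eval2 (Tpol p s lam) a - f a)) (\<lambda>_. 0) sequentially" for k
    proof (cases "?D = {}")
      case True
      then show ?thesis by (simp add: nonarch_analytic_on_def)
    next
      case False
      show ?thesis
        by (rule ratio_cauchy_converges_to_analytic[OF complete Np char_0 D D_open B])
          (use that(2)[OF False] in auto)
    qed
  qed
  have nonzero: "\<not> of_nat p dvd dwork_coeff p (\<lambda>i. digit_poly p (w (l + i))) n" if "?D \<noteq> {}" for l n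
  proof
    assume dvd: "of_nat p dvd dwork_coeff p (\<lambda>i. digit_poly p (w (l + i))) n"
    obtain a where a: "a \<in> ?D" using \<open>?D \<noteq> {}\<close> by blast
    show False using eval2_dvd_le[OF D[OF a] dvd] T_unit[OF a, of l n] Np by simp
  qed
  note integrals = ratio_cauchy_integrals[OF p assms(4,5,7) w expansion nonzero]
  show ?thesis
    by (intro conjI allI main) (use integrals in auto)
qed

end
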